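(* Let $O\subset\Theta\subset\mathbb{R}^m$ with $O$ open and definable, and let $f:\mathbb{R}^n\times O\to\mathbb{R}$, $g:\mathbb{R}^n\times O\to\mathbb{R}\cup\{+\infty\}$ satisfy the composite definability, composite regularity, composite uniform range and composite uniform kernel assumptions, with constants $L,\bar\varepsilon,\gamma$ (see context). Fix $\theta\in O$, let $\varepsilon_k\downarrow0$ with $0<\varepsilon_k\le\bar\varepsilon$, and select $D_k=(Q_k,P_k,H_k^f,M_k^f)\in\mathcal{D}_{\varepsilon_k}(x^\star_{\varepsilon_k}(\theta),\theta)$ with $D_k\to D_0=(Q_0,P_0,H_0^f,M_0^f)$. Write $\Pi_k:=\Pi_{Q_k}$, $\mathcal{M}_k:=\gamma Q_kM_k^f-P_k$, $\Sigma_k:=\Sigma(D_k)$, $V_k:=V(D_k)$, $T_k:=T_{\varepsilon_k}(D_k)$, $$J_k:=-H_{\varepsilon_k}(D_k)^{-1}\mathcal{M}_k=-(I_n-\Pi_k)\mathcal{M}_k-T_k^\dagger V_k,$$ and define $\Pi_0,\mathcal{M}_0,\Sigma_0,V_0$ analogously from $D_0$. Suppose that $\operatorname{rank}(Q_k)=\operatorname{rank}(Q_0)$ for all sufficiently large $k$, and that at least one of the following holds: (i) for some $\lambda^*>0$, $\operatorname{spec}(\Sigma_k)\subset\{0\}\cup[\lambda^*,+\infty[$ for all sufficiently large $k$; (ii) with eigenvalues in nonincreasing order, $\lambda_i(\Sigma_k)\to0$ implies $\lambda_i(\Sigma_k)=o(\varepsilon_k)$, for $i=1,\dots,n$. Then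 every cluster point $J$ of $(J_k)_k$ satisfies $$J=-(I_n-\Pi_0)\mathcal{M}_0-\Sigma_0^\dagger V_0.$$ (Equivalently, every such $J$ is realized along a subsequence for which $R_k:=T_k^\dagger\Sigma_k\to R$, $W_k:=\Sigma_k^\dagger V_k\to W$ and $J=-(I_n-\Pi_0)\mathcal{M}_0-\Sigma_0^\dagger V_0-SW$ with $S:=R-\Sigma_0^\dagger\Sigma_0=0$.)
   Context: Definability is relative to a fixed o-minimal structure expanding the real field. $\|\cdot\|$ is the Euclidean/operator norm, $\dagger$ the Moore–Penrose pseudoinverse, $\partial$ the Clarke Jacobian, $\Gamma_0(\mathbb{R}^n)$ the set of proper lower semicontinuous convex functions, $\operatorname{prox}_h(z)=\operatorname{argmin}_y\{h(y)+\frac12\|y-z\|_2^2\}$. Composite definability: $f$, $g$ and $\Theta$ are definable. Composite regularity: for every $\theta\in O$, $f(\cdot,\theta)\in\mathcal{C}^{1,1}(\mathbb{R}^n)\cap\Gamma_0(\mathbb{R}^n)$, $g(\cdot,\theta)\in\Gamma_0(\mathbb{R}^n)$, and $\mathcal{S}_c(\theta):=\operatorname{argmin}_x\{f(x,\theta)+g(x,\theta)\}\neq\emptyset$; $\nabla_xf$ is jointly locally Lipschitz on $\mathbb{R}^n\times O$ and, for some $L\ge0$, $\nabla_xf(\cdot,\theta)$ is $L$-Lipschitz for every $\theta\in O$. Fixed are $\bar\varepsilon>0$ and $0<\gamma<2/(L+2\bar\varepsilon)$ such that $G^\gamma(z,\theta):=\operatorname{prox}_{\gamma g(\cdot,\theta)}(z)$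 is jointly locally Lipschitz on $\mathbb{R}^n\times O$. For $0<\varepsilon\le\bar\varepsilon$, $x^\star_\varepsilon(\theta):=\operatorname{argmin}_x\{f(x,\theta)+g(x,\theta)+\frac\varepsilon2\|x\|_2^2\}$. Set $z_\varepsilon(x,\theta):=x-\gamma(\nabla_xf(x,\theta)+\varepsilon x)$, and let $\mathcal{D}_\varepsilon(x,\theta)$ be the set of $D=(Q,P,H^f,M^f)$ with $(Q\ P)\in\partial G^\gamma(z_\varepsilon(x,\theta),\theta)$ and $(H^f\ M^f)\in\partial(\nabla_xf)(x,\theta)$ (joint Clarke Jacobians), $Q,H^f\in\mathbb{R}^{n\times n}$, $P,M^f\in\mathbb{R}^{n\times m}$. For such $D$, with $\Pi_Q:=QQ^\dagger$, $$H_\varepsilon(D):=I_n-Q((1-\gamma\varepsilon)I_n-\gamma H^f),\quad M_\varepsilon(D):=\gamma QM^f-P,\quad\Sigma(D):=Q^\dagger-\Pi_Q+\gamma\Pi_QH^f\Pi_Q,$$ $$V(D):=Q^\dagger M_\varepsilon(D)-\gamma\Pi_QH^f(I_n-\Pi_Q)M_\varepsilon(D),\quad T_\varepsilon(D):=\Sigma(D)+\gamma\varepsilon\Pi_Q.$$ ($M_\varepsilon(D)$, $\Sigma(D)$, $V(D)$ do not depend explicitly on $\varepsilon$.) Composite uniform range assumption: for every compact $K\subset O$ there exists $C_K>0$ such that, for every $\theta\in K$, $\varepsilon\in\,]0,\bar\varepsilon]$ and $D\in\mathcal{D}_\varepsilon(x^\star_\varepsilon(\theta),\theta)$, $\operatorname{range}(V(D))\subseteq\operatorname{range}(\Sigma(D))$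 and $\|\Sigma(D)^\dagger V(D)\|\le C_K$. Composite uniform kernel assumption: for every compact $K\subset O$ there exists $B_K\ge0$ such that, for the same $\theta,\varepsilon,D$, $\|(I_n-\Pi_Q)M_\varepsilon(D)\|=\|(I_n-\Pi_Q)P\|\le B_K$. *)

theory Defs
  imports
    "HOL-Analysis.Analysis"
    "HOL-Computational_Algebra.Polynomial_Factorial"
    "HOL-Library.Landau_Symbols"
begin

section \<open>O-minimal structures and definability\<close>

inductive polynomial_fun :: "nat \<Rightarrow> (real list \<Rightarrow> real) \<Rightarrow> bool" for d where
  const: "polynomial_fun d (\<lambda>xs. c)"
| coord: "i < d \<Longrightarrow> polynomial_fun d (\<lambda>xs. xs ! i)"
| add: "polynomial_fun d p \<Longrightarrow> polynomial_fun d q \<Longrightarrow> polynomial_fun d (\<lambda>xs. p xs + q xs)"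
| mult: "polynomial_fun d p \<Longrightarrow> polynomial_fun d q \<Longrightarrow> polynomial_fun d (\<lambda>xs. p xs * q xs)"

text \<open>
  All dimensions have to be considered simultaneously, so points of $d$-space are represented
  here by lists of length \<open>d\<close>, and \<open>S d\<close> is the family of definable subsets of $d$-space.
  Containing all real algebraic sets (zero sets of polynomials with arbitrary real coefficients)
  is what makes the structure an expansion of the real field.
\<close>

definition o_minimal_structure :: "(nat \<Rightarrow> real list set set) \<Rightarrow> bool" where
  "o_minimal_structure S \<longleftrightarrow>
     (\<forall>d. algebra {xs. length xs = d} (S d)) \<and>
     (\<forall>d. \<forall>A \<in> S d. {xs @ [t] |xs t. xs \<in> A} \<in> S (Suc d) \<and> {t # xs |xs t. xs \<in> A} \<in> S (Suc d)) \<and>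
     (\<forall>d. \<forall>A \<in> S (Suc d). butlast ` A \<in> S d) \<and>
     (\<forall>d p. polynomial_fun d p \<longrightarrow> {xs. length xs = d \<and> p xs = 0} \<in> S d) \<and>
     (\<forall>A \<in> S 1. \<exists>\<I>. finite \<I> \<and> (\<forall>I \<in> \<I>. is_interval I) \<and> {t. [t] \<in> A} = \<Union>\<I>)"

text \<open>
  Vectors over a finite index type are turned into lists by an arbitrary but fixed enumeration of
  the index type; definability does not depend on the choice, since \<open>S\<close> is closed under
  permutation of coordinates.
\<close>

definition index_list :: "'n::finite list" where
  "index_list = (SOME is. distinct is \<and> set is = UNIV)"

definition coords :: "real^'n \<Rightarrow> real list" where
  "coords x = map (\<lambda>i. x $ i) index_list"

definition definable_set :: "(nat \<Rightarrow> real list set set) \<Rightarrow> (real^'n) set \<Rightarrow> bool" where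
  "definable_set S A \<longleftrightarrow> coords ` A \<in> S CARD('n)"

text \<open>
  An extended-real-valued function is definable if its graph over its effective domain is.
\<close>

definition definable_fun ::
    "(nat \<Rightarrow> real list set set) \<Rightarrow> ((real^'n) \<times> (real^'m)) set \<Rightarrow> (real^'n \<Rightarrow> real^'m \<Rightarrow> ereal) \<Rightarrow> bool" where
  "definable_fun S U h \<longleftrightarrow>
     {coords x @ coords \<theta> @ [t] |x \<theta> t. (x, \<theta>) \<in> U \<and> h x \<theta> = ereal t} \<in> S (CARD('n) + CARD('m) + 1)"


section \<open>Convex and nonsmooth analysis\<close>

definition Gamma0 :: "('a::real_normed_vector \<Rightarrow> ereal) set" where
  "Gamma0 = {h.
     (\<forall>x. h x \<noteq> -\<infinity>) \<and> (\<exists>x. h x \<noteq> \<infinity>) \<and>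
     (\<forall>x. h x \<le> Liminf (at x) h) \<and>
     (\<forall>x y t. 0 < t \<and> t < 1 \<longrightarrow>
        h ((1 - t) *\<^sub>R x + t *\<^sub>R y) \<le> ereal (1 - t) * h x + ereal t * h y)}"

definition argmin_set :: "('a \<Rightarrow> ereal) \<Rightarrow> 'a set" where
  "argmin_set h = {x. \<forall>y. h x \<le> h y}"

definition prox :: "('a::real_inner \<Rightarrow> ereal) \<Rightarrow> 'a \<Rightarrow> 'a" where
  "prox h z = (THE y. y \<in> argmin_set (\<lambda>y. h y + ereal (1 / 2 * (norm (y - z))\<^sup>2)))"

definition grad :: "('a::real_inner \<Rightarrow> real) \<Rightarrow> 'a \<Rightarrow> 'a" where
  "grad h x = (THE d. GDERIV h x :> d)"

definition C11 :: "('a::real_inner \<Rightarrow> real) set" where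
  "C11 = {h. (\<forall>x. \<exists>d. GDERIV h x :> d) \<and> (\<exists>K. K-lipschitz_on UNIV (grad h))}"

definition locally_lipschitz_on :: "'a::metric_space set \<Rightarrow> ('a \<Rightarrow> 'b::metric_space) \<Rightarrow> bool" where
  "locally_lipschitz_on U F \<longleftrightarrow> (\<forall>p \<in> U. \<exists>r > 0. \<exists>K. K-lipschitz_on (ball p r \<inter> U) F)"

text \<open>
  Only the values of \<open>F\<close> near \<open>p\<close> matter. The Jacobian consists of linear maps; \<open>block_row\<close> below
  turns a matrix pair \<open>(Q P)\<close> into the corresponding map on the product space.
\<close>

definition clarke_jacobian ::
    "('a::euclidean_space \<Rightarrow> 'b::euclidean_space) \<Rightarrow> 'a \<Rightarrow> ('a \<Rightarrow>\<^sub>L 'b) set" where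
  "clarke_jacobian F p = convex hull
     {A. \<exists>q B. q \<longlonglongrightarrow> p \<and> (\<forall>j. (F has_derivative blinfun_apply (B j)) (at (q j))) \<and> B \<longlonglongrightarrow> A}"

definition block_row :: "real^'n^'k \<Rightarrow> real^'m^'k \<Rightarrow> ((real^'n) \<times> (real^'m)) \<Rightarrow>\<^sub>L (real^'k)" where
  "block_row Q P = Blinfun (\<lambda>(u, v). Q *v u + P *v v)"


section \<open>Matrices\<close>

definition pinv :: "real^'n^'m \<Rightarrow> real^'m^'n" where
  "pinv A = (THE X. A ** X ** A = A \<and> X ** A ** X = X \<and>
                    transpose (A ** X) = A ** X \<and> transpose (X ** A) = X ** A)"

text \<open>The type-class norm of a matrix is the Frobenius norm, hence this separate notion.\<close>

definition opnorm :: "real^'n^'m \<Rightarrow> real" where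
  "opnorm A = onorm (\<lambda>x. A *v x)"

text \<open>
  The next two notions concern real eigenvalues. They are only applied to symmetric matrices,
  for which all complex eigenvalues are real and \<open>eigvals_desc A\<close> has length \<open>CARD('n)\<close>.
\<close>

definition spec_real :: "real^'n^'n \<Rightarrow> real set" where
  "spec_real A = {\<mu>. \<exists>v. v \<noteq> 0 \<and> A *v v = \<mu> *\<^sub>R v}"

definition char_polynomial :: "real^'n^'n \<Rightarrow> real poly" where
  "char_polynomial A = det (\<chi> i j. (if i = j then [:0, 1:] else 0) - [:A $ i $ j:])"

definition eigvals_desc :: "real^'n^'n \<Rightarrow> real list" where
  "eigvals_desc A = rev (sorted_list_of_multiset (proots (char_polynomial A)))"


section \<open>The composite problem\<close>

definition composite_definability ::
    "(nat \<Rightarrow> real list set set) \<Rightarrow> (real^'m) set \<Rightarrow> (real^'m) set \<Rightarrow>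
     (real^'n \<Rightarrow> real^'m \<Rightarrow> real) \<Rightarrow> (real^'n \<Rightarrow> real^'m \<Rightarrow> ereal) \<Rightarrow> bool" where
  "composite_definability S \<Theta> \<O> f g \<longleftrightarrow>
     definable_fun S (UNIV \<times> \<O>) (\<lambda>x \<theta>. ereal (f x \<theta>)) \<and>
     definable_fun S (UNIV \<times> \<O>) g \<and>
     definable_set S \<Theta>"

definition grad_x :: "(real^'n \<Rightarrow> real^'m \<Rightarrow> real) \<Rightarrow> (real^'n) \<times> (real^'m) \<Rightarrow> real^'n" where
  "grad_x f = (\<lambda>(x, \<theta>). grad (\<lambda>y. f y \<theta>) x)"

definition prox_map :: "real \<Rightarrow> (real^'n \<Rightarrow> real^'m \<Rightarrow> ereal) \<Rightarrow> (real^'n) \<times> (real^'m) \<Rightarrow> real^'n" where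
  "prox_map \<gamma> g = (\<lambda>(z, \<theta>). prox (\<lambda>y. ereal \<gamma> * g y \<theta>) z)"

definition composite_regularity ::
    "(real^'m) set \<Rightarrow> (real^'n \<Rightarrow> real^'m \<Rightarrow> real) \<Rightarrow> (real^'n \<Rightarrow> real^'m \<Rightarrow> ereal) \<Rightarrow>
     real \<Rightarrow> real \<Rightarrow> real \<Rightarrow> bool" where
  "composite_regularity \<O> f g L \<epsilon>\<^sub>b \<gamma> \<longleftrightarrow>
     (\<forall>\<theta> \<in> \<O>. (\<lambda>x. f x \<theta>) \<in> C11 \<and> (\<lambda>x. ereal (f x \<theta>)) \<in> Gamma0 \<and> (\<lambda>x. g x \<theta>) \<in> Gamma0 \<and>
        argmin_set (\<lambda>x. ereal (f x \<theta>) + g x \<theta>) \<noteq> {}) \<and>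
     locally_lipschitz_on (UNIV \<times> \<O>) (grad_x f) \<and>
     0 \<le> L \<and> (\<forall>\<theta> \<in> \<O>. L-lipschitz_on UNIV (\<lambda>x. grad_x f (x, \<theta>))) \<and>
     0 < \<epsilon>\<^sub>b \<and> 0 < \<gamma> \<and> \<gamma> < 2 / (L + 2 * \<epsilon>\<^sub>b) \<and>
     locally_lipschitz_on (UNIV \<times> \<O>) (prox_map \<gamma> g)"

definition xstar ::
    "(real^'n \<Rightarrow> real^'m \<Rightarrow> real) \<Rightarrow> (real^'n \<Rightarrow> real^'m \<Rightarrow> ereal) \<Rightarrow> real \<Rightarrow> real^'m \<Rightarrow> real^'n" where
  "xstar f g \<epsilon> \<theta> =
     (THE x. x \<in> argmin_set (\<lambda>x. ereal (f x \<theta>) + g x \<theta> + ereal (\<epsilon> / 2 * (norm x)\<^sup>2)))"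

definition z_eps ::
    "(real^'n \<Rightarrow> real^'m \<Rightarrow> real) \<Rightarrow> real \<Rightarrow> real \<Rightarrow> real^'n \<Rightarrow> real^'m \<Rightarrow> real^'n" where
  "z_eps f \<gamma> \<epsilon> x \<theta> = x - \<gamma> *\<^sub>R (grad_x f (x, \<theta>) + \<epsilon> *\<^sub>R x)"

text \<open>An element \<open>(Q, P, H, M)\<close> of the following type stands for $(Q, P, H^f, M^f)$.\<close>

type_synonym ('n, 'm) blocks =
  "(real^'n^'n) \<times> (real^'m^'n) \<times> (real^'n^'n) \<times> (real^'m^'n)"

definition D_set ::
    "(real^'n \<Rightarrow> real^'m \<Rightarrow> real) \<Rightarrow> (real^'n \<Rightarrow> real^'m \<Rightarrow> ereal) \<Rightarrow> real \<Rightarrow> real \<Rightarrow>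
     real^'n \<Rightarrow> real^'m \<Rightarrow> ('n, 'm) blocks set" where
  "D_set f g \<gamma> \<epsilon> x \<theta> = {(Q, P, H, M).
     block_row Q P \<in> clarke_jacobian (prox_map \<gamma> g) (z_eps f \<gamma> \<epsilon> x \<theta>, \<theta>) \<and>
     block_row H M \<in> clarke_jacobian (grad_x f) (x, \<theta>)}"

fun Q_mat :: "('n::finite, 'm::finite) blocks \<Rightarrow> real^'n^'n" where
  "Q_mat (Q, P, H, M) = Q"

fun Pi_mat :: "('n::finite, 'm::finite) blocks \<Rightarrow> real^'n^'n" where
  "Pi_mat (Q, P, H, M) = Q ** pinv Q"

fun H_eps :: "real \<Rightarrow> real \<Rightarrow> ('n::finite, 'm::finite) blocks \<Rightarrow> real^'n^'n" where
  "H_eps \<gamma> \<epsilon> (Q, P, H, M) = mat 1 - Q ** ((1 - \<gamma> * \<epsilon>) *\<^sub>R mat 1 - \<gamma> *\<^sub>R H)"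

fun M_mat :: "real \<Rightarrow> ('n::finite, 'm::finite) blocks \<Rightarrow> real^'m^'n" where
  "M_mat \<gamma> (Q, P, H, M) = \<gamma> *\<^sub>R (Q ** M) - P"

fun Sigma_mat :: "real \<Rightarrow> ('n::finite, 'm::finite) blocks \<Rightarrow> real^'n^'n" where
  "Sigma_mat \<gamma> (Q, P, H, M) =
     (let Pr = Pi_mat (Q, P, H, M) in pinv Q - Pr + \<gamma> *\<^sub>R (Pr ** H ** Pr))"

fun V_mat :: "real \<Rightarrow> ('n::finite, 'm::finite) blocks \<Rightarrow> real^'m^'n" where
  "V_mat \<gamma> (Q, P, H, M) =
     (let Pr = Pi_mat (Q, P, H, M); N = M_mat \<gamma> (Q, P, H, M)
      in pinv Q ** N - \<gamma> *\<^sub>R (Pr ** H ** (mat 1 - Pr) ** N))"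

definition T_eps :: "real \<Rightarrow> real \<Rightarrow> ('n::finite, 'm::finite) blocks \<Rightarrow> real^'n^'n" where
  "T_eps \<gamma> \<epsilon> D = Sigma_mat \<gamma> D + (\<gamma> * \<epsilon>) *\<^sub>R Pi_mat D"

definition J_eps :: "real \<Rightarrow> real \<Rightarrow> ('n::finite, 'm::finite) blocks \<Rightarrow> real^'m^'n" where
  "J_eps \<gamma> \<epsilon> D = - (matrix_inv (H_eps \<gamma> \<epsilon> D) ** M_mat \<gamma> D)"

definition composite_uniform_range ::
    "(real^'m) set \<Rightarrow> (real^'n \<Rightarrow> real^'m \<Rightarrow> real) \<Rightarrow> (real^'n \<Rightarrow> real^'m \<Rightarrow> ereal) \<Rightarrow>
     real \<Rightarrow> real \<Rightarrow> bool" where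
  "composite_uniform_range \<O> f g \<epsilon>\<^sub>b \<gamma> \<longleftrightarrow>
     (\<forall>K. compact K \<and> K \<subseteq> \<O> \<longrightarrow>
       (\<exists>C > 0. \<forall>\<theta> \<in> K. \<forall>\<epsilon> \<in> {0<..\<epsilon>\<^sub>b}. \<forall>D \<in> D_set f g \<gamma> \<epsilon> (xstar f g \<epsilon> \<theta>) \<theta>.
          range (\<lambda>v. V_mat \<gamma> D *v v) \<subseteq> range (\<lambda>u. Sigma_mat \<gamma> D *v u) \<and>
          opnorm (pinv (Sigma_mat \<gamma> D) ** V_mat \<gamma> D) \<le> C))"

definition composite_uniform_kernel ::
    "(real^'m) set \<Rightarrow> (real^'n \<Rightarrow> real^'m \<Rightarrow> real) \<Rightarrow> (real^'n \<Rightarrow> real^'m \<Rightarrow> ereal) \<Rightarrow>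
     real \<Rightarrow> real \<Rightarrow> bool" where
  "composite_uniform_kernel \<O> f g \<epsilon>\<^sub>b \<gamma> \<longleftrightarrow>
     (\<forall>K. compact K \<and> K \<subseteq> \<O> \<longrightarrow>
       (\<exists>B \<ge> 0. \<forall>\<theta> \<in> K. \<forall>\<epsilon> \<in> {0<..\<epsilon>\<^sub>b}. \<forall>D \<in> D_set f g \<gamma> \<epsilon> (xstar f g \<epsilon> \<theta>) \<theta>.
          opnorm ((mat 1 - Pi_mat D) ** M_mat \<gamma> D) \<le> B))"

definition cluster_point :: "(nat \<Rightarrow> 'a::metric_space) \<Rightarrow> 'a \<Rightarrow> bool" where
  "cluster_point X l \<longleftrightarrow> (\<exists>r. strict_mono r \<and> (X \<circ> r) \<longlonglongrightarrow> l)"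

end

(*
  Every Clarke Jacobian of the proximal map has a symmetric first block Q with |Q u|^2 <= <Q u, u>,
  because prox is firmly nonexpansive and is the gradient of a Legendre conjugate; likewise the first
  block H of a Clarke Jacobian of the gradient of the convex function f is symmetric and positive
  semidefinite.  Hence Sigma is symmetric positive semidefinite with range inside range(Q), T is
  invertible there, and splitting along range(Q) solves H_eps X = M explicitly.

  The pseudoinverse is continuous along sequences of symmetric matrices of constant rank, so Pi, Sigma
  and V converge.  By the range assumption T^+ V = R W with R = T^+ Sigma and W = Sigma^+ V bounded.
  An orthonormal eigenbasis of Sigma diagonalizes R, with eigenvalues l/(l + gamma eps).  Alternative (i)
  forces eigenvalues that tend to 0 to vanish eventually, so it implies (ii); under (ii) these ratios tend
  to 0 or 1, according to whether the limit eigenvalue is zero or not, hence R tends to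
  Sigma_0^+ Sigma_0.  Since Sigma_0 W_0 = V_0 for every limit W_0 of W, T^+ V tends to Sigma_0^+ V_0.
*)
theory Submission
  imports Defs
begin

text \<open>The delicate point is that Sigma_k may lose rank in the limit even though Q_k does not.
  Then neither T_k^+ nor Sigma_k^+ need stay bounded, and T_k^+ V_k has no limit factor by factor.
  Writing it as R_k W_k repairs this: the eigenvalues l/(l + gamma eps) of R_k lie in [0,1], and W_k
  is bounded by assumption. An eigenvalue of the same order as eps_k would send its ratio strictly
  between 0 and 1 and leave a term S W; the two alternatives exclude exactly this. Eigenvectors do
  not depend continuously on the matrix, so spectral limits are taken along subsequences on which a
  chosen eigenbasis converges; the limits \<open>pinv A0\<close> and \<open>pinv S0 ** S0\<close> do
  not depend on the eigenbasis reached. Eigenvalues in decreasing order do converge along the full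
  sequence, and alternative (ii), a statement about full sequences, can only be applied because of
  that. A Clarke Jacobian is generated by derivatives at points where the map is merely
  differentiable. Symmetry of second derivatives is therefore needed for a gradient that is
  differentiable at a single point, without any C^2 assumption.\<close>

subsection \<open>Derivatives of gradients and of monotone maps\<close>

text \<open>Peano's argument: the mean value theorem for \<open>s \<mapsto> \<phi> (x + s u + t v) - \<phi> (x + s u)\<close> on \<open>[0, t]\<close>.\<close>

lemma gderiv_second_difference:
  fixes \<phi> :: "'a::real_inner \<Rightarrow> real" and F :: "'a \<Rightarrow> 'a"
  assumes grad: "\<And>y. GDERIV \<phi> y :> F y"
    and near: "\<And>h. norm h < d \<Longrightarrow> norm (F (x + h) - F x - A h) \<le> e * norm h"
    and A: "linear A"
    and t: "0 < t" "t * (norm u + norm v) < d"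
  shows "\<bar>\<phi> (x + t *\<^sub>R u + t *\<^sub>R v) - \<phi> (x + t *\<^sub>R u) - \<phi> (x + t *\<^sub>R v) + \<phi> x - t\<^sup>2 * (A v \<bullet> u)\<bar>
    \<le> t\<^sup>2 * (2 * e * (norm u + norm v) * norm u)"
proof -
  define \<psi> where "\<psi> s = \<phi> (x + s *\<^sub>R u + t *\<^sub>R v) - \<phi> (x + s *\<^sub>R u)" for s
  have d: "((\<lambda>s. \<phi> (w + s *\<^sub>R u)) has_real_derivative (u \<bullet> F (w + s *\<^sub>R u))) (at s)" for w s
  proof -
    have "(\<phi> has_derivative (\<lambda>h. h \<bullet> F (w + s *\<^sub>R u))) (at (w + s *\<^sub>R u))"
      using grad[of "w + s *\<^sub>R u"] by (simp add: gderiv_def)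
    then have "((\<lambda>s. \<phi> (w + s *\<^sub>R u)) has_derivative (\<lambda>h. (h *\<^sub>R u) \<bullet> F (w + s *\<^sub>R u))) (at s)"
      by (intro has_derivative_compose[of "\<lambda>s. w + s *\<^sub>R u" "\<lambda>h. h *\<^sub>R u" s UNIV \<phi>, simplified])
        (auto intro!: derivative_eq_intros)
    then show ?thesis
      by (simp add: has_field_derivative_def mult_commute_abs)
  qed
  have "(\<psi> has_real_derivative (u \<bullet> F (x + t *\<^sub>R v + s *\<^sub>R u) - u \<bullet> F (x + s *\<^sub>R u))) (at s)" for s
    using DERIV_diff[OF d[of "x + t *\<^sub>R v"] d[of x]] by (simp add: \<psi>_def[abs_def] algebra_simps)
  then obtain s where s: "0 < s" "s < t"
    and mv: "\<psi> t - \<psi> 0 = (t - 0) * (u \<bullet> F (x + t *\<^sub>R v + s *\<^sub>R u) - u \<bullet> F (x + s *\<^sub>R u))"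
    using MVT2[of 0 t \<psi> "\<lambda>s. u \<bullet> F (x + t *\<^sub>R v + s *\<^sub>R u) - u \<bullet> F (x + s *\<^sub>R u)"] t by blast
  define h1 h2 where "h1 = t *\<^sub>R v + s *\<^sub>R u" and "h2 = s *\<^sub>R u"
  have "s * norm u \<le> t * norm u" using s by (intro mult_right_mono) auto
  then have n: "norm h1 \<le> t * (norm u + norm v)" "norm h2 \<le> t * (norm u + norm v)"
    unfolding h1_def h2_def using s t norm_triangle_ineq[of "t *\<^sub>R v" "s *\<^sub>R u"]
    by (auto simp: algebra_simps add_increasing2)
  define r1 r2 where "r1 = F (x + h1) - F x - A h1" and "r2 = F (x + h2) - F x - A h2"
  have r: "norm r1 \<le> e * (t * (norm u + norm v))" "norm r2 \<le> e * (t * (norm u + norm v))"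
  proof -
    \<comment> \<open>The sign of \<open>e\<close> is not assumed. It follows from
      \<open>near\<close> at any nonzero small \<open>h\<close>, and if \<open>u\<close> and
      \<open>v\<close> both vanish the remainders are taken at 0 and the bound is trivial.\<close>
    have "0 \<le> e \<or> u = 0 \<and> v = 0"
    proof (cases "u = 0 \<and> v = 0")
      case False
      define h where "h = t *\<^sub>R (if u = 0 then v else u)"
      have "h \<noteq> 0" using False t by (auto simp: h_def)
      moreover have "norm h \<le> t * (norm u + norm v)" using t by (auto simp: h_def)
      ultimately have "0 \<le> e * norm h" using near[of h] t by (smt (verit) norm_ge_zero)
      then show ?thesis using \<open>h \<noteq> 0\<close> by (simp add: zero_le_mult_iff)
    qed auto
    moreover have "norm r1 \<le> e * norm h1" "norm r2 \<le> e * norm h2"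
      unfolding r1_def r2_def using n t by (auto intro!: near)
    ultimately show "norm r1 \<le> e * (t * (norm u + norm v))" "norm r2 \<le> e * (t * (norm u + norm v))"
      using n mult_left_mono[OF n(1), of e] mult_left_mono[OF n(2), of e]
      by (auto simp: h1_def h2_def)
  qed
  have "A h1 - A h2 = t *\<^sub>R A v"
    unfolding h1_def h2_def by (simp add: linear_add[OF A] linear_scale[OF A])
  then have "F (x + h1) - F (x + h2) = t *\<^sub>R A v + (r1 - r2)"
    by (simp add: r1_def r2_def algebra_simps)
  then have "\<psi> t - \<psi> 0 = t * (u \<bullet> (t *\<^sub>R A v + (r1 - r2)))"
    using mv by (simp add: h1_def h2_def inner_diff_right[symmetric] add.assoc)
  then have "\<psi> t - \<psi> 0 - t\<^sup>2 * (A v \<bullet> u) = t * (u \<bullet> (r1 - r2))"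
    by (simp add: inner_add_right inner_commute power2_eq_square algebra_simps)
  moreover have "\<bar>t * (u \<bullet> (r1 - r2))\<bar> \<le> t * (norm u * (2 * (e * (t * (norm u + norm v)))))"
  proof -
    have "\<bar>u \<bullet> (r1 - r2)\<bar> \<le> norm u * norm (r1 - r2)" by (rule Cauchy_Schwarz_ineq2)
    also have "\<dots> \<le> norm u * (2 * (e * (t * (norm u + norm v))))"
      using r norm_triangle_ineq4[of r1 r2] by (intro mult_left_mono) auto
    finally show ?thesis using t by (simp add: abs_mult)
  qed
  ultimately show ?thesis
    by (simp add: \<psi>_def power2_eq_square algebra_simps)
qed

text \<open>The second difference of the potential does not change when \<open>u\<close> and
  \<open>v\<close> are swapped, yet it approximates both t^2 (A v . u) and t^2 (A u . v) up to
  o(t^2). Differentiability of the gradient at the one point \<open>x\<close> is enough.\<close>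

lemma gderiv_second_derivative_symmetric:
  fixes \<phi> :: "'a::real_inner \<Rightarrow> real"
  assumes grad: "\<And>y. GDERIV \<phi> y :> F y" and F: "(F has_derivative A) (at x)"
  shows "A u \<bullet> v = u \<bullet> A v"
proof -
  define C where "C = 2 * (norm u + norm v) * (norm u + norm v)"
  have lin: "linear A" using F has_derivative_linear by blast
  have "\<bar>A v \<bullet> u - A u \<bullet> v\<bar> \<le> e * C" if "e > 0" for e
  proof -
    obtain d where d: "d > 0" "\<And>y. norm (y - x) < d \<Longrightarrow> norm (F y - F x - A (y - x)) \<le> e * norm (y - x)"
      using F \<open>e > 0\<close> unfolding has_derivative_at_alt by blast
    then have near: "norm h < d \<Longrightarrow> norm (F (x + h) - F x - A h) \<le> e * norm h" for h
      using d(2)[of "x + h"] by simp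
    \<comment> \<open>The \<open>+ 1\<close> keeps the denominator positive when
      \<open>u = v = 0\<close>.\<close>
    define t where "t = d / (norm u + norm v + 1)"
    have p: "norm u + norm v + 1 > 0" by (smt (verit) norm_ge_zero)
    have t: "t > 0" using d p by (simp add: t_def)
    have "t * (norm u + norm v) < t * (norm u + norm v + 1)" using t by simp
    also have "\<dots> = d" using p by (simp add: t_def)
    finally have td: "t * (norm u + norm v) < d" .
    define \<Delta> where "\<Delta> = \<phi> (x + t *\<^sub>R u + t *\<^sub>R v) - \<phi> (x + t *\<^sub>R u) - \<phi> (x + t *\<^sub>R v) + \<phi> x"
    have 1: "\<bar>\<Delta> - t\<^sup>2 * (A v \<bullet> u)\<bar> \<le> t\<^sup>2 * (2 * e * (norm u + norm v) * norm u)"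
      unfolding \<Delta>_def by (rule gderiv_second_difference[OF grad near lin t td])
    have 2: "\<bar>\<Delta> - t\<^sup>2 * (A u \<bullet> v)\<bar> \<le> t\<^sup>2 * (2 * e * (norm u + norm v) * norm v)"
      using gderiv_second_difference[OF grad near lin t, where u = v and v = u] td
      unfolding \<Delta>_def by (simp add: algebra_simps)
    have "t\<^sup>2 * \<bar>A v \<bullet> u - A u \<bullet> v\<bar> = \<bar>t\<^sup>2 * (A v \<bullet> u) - t\<^sup>2 * (A u \<bullet> v)\<bar>"
      by (simp add: abs_mult right_diff_distrib[symmetric])
    also have "\<dots> \<le> t\<^sup>2 * (2 * e * (norm u + norm v) * norm u) + t\<^sup>2 * (2 * e * (norm u + norm v) * norm v)"
      using 1 2 by linarith
    also have "\<dots> = t\<^sup>2 * (e * C)" by (simp add: C_def algebra_simps)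
    finally show ?thesis using t by simp
  qed
  moreover have "C \<ge> 0" by (simp add: C_def)
  ultimately have "\<bar>A v \<bullet> u - A u \<bullet> v\<bar> \<le> 0 + e'" if "e' > 0" for e'
  proof (cases "C = 0")
    case False
    then have "e' / C > 0" using that \<open>C \<ge> 0\<close> by simp
    then show ?thesis using \<open>\<And>e. e > 0 \<Longrightarrow> _ \<le> e * C\<close>[of "e' / C"] False by simp
  qed (use \<open>\<And>e. e > 0 \<Longrightarrow> _ \<le> e * C\<close>[of 1] that in simp)
  then have "\<bar>A v \<bullet> u - A u \<bullet> v\<bar> \<le> 0" by (rule field_le_epsilon)
  then show ?thesis by (simp add: inner_commute)
qed

text \<open>The inequality is applied to \<open>x + t v\<close> and \<open>x\<close>; dividing by
  t^2 turns both sides into expressions in the difference quotient, which pass to the limit. The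
  case c = 1 serves the proximal map and c = 0 the gradient of a convex function.\<close>

lemma cocoercive_derivative:
  fixes F :: "'a::real_inner \<Rightarrow> 'a"
  assumes mono: "\<And>x y. c * (norm (F x - F y))\<^sup>2 \<le> (F x - F y) \<bullet> (x - y)"
    and F: "(F has_derivative A) (at x)"
  shows "c * (norm (A v))\<^sup>2 \<le> A v \<bullet> v"
proof -
  define q where "q t = (F (x + t *\<^sub>R v) - F x) /\<^sub>R t" for t :: real
  have "((\<lambda>t. F (x + t *\<^sub>R v)) has_derivative (\<lambda>h. A (h *\<^sub>R v))) (at 0)"
    using F by (intro has_derivative_compose[of "\<lambda>s. x + s *\<^sub>R v" "\<lambda>h. h *\<^sub>R v" 0 UNIV F, simplified])
        (auto intro!: derivative_eq_intros)
  then have lim: "((\<lambda>t. norm (F (x + t *\<^sub>R v) - F x - A (t *\<^sub>R v)) / norm t) \<longlongrightarrow> 0) (at 0)"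
    by (simp add: has_derivative_at)
  have eq: "norm (F (x + t *\<^sub>R v) - F x - A (t *\<^sub>R v)) / norm t = norm (q t - A v)" if "t \<noteq> 0" for t
  proof -
    have "q t - A v = (F (x + t *\<^sub>R v) - F x - A (t *\<^sub>R v)) /\<^sub>R t"
      using that has_derivative_linear[OF F] by (simp add: q_def linear_scale scaleR_right_diff_distrib)
    then show ?thesis by (simp add: divide_inverse mult.commute)
  qed
  have "((\<lambda>t. norm (q t - A v)) \<longlongrightarrow> 0) (at 0)"
    by (rule Lim_transform_eventually[OF lim]) (unfold eventually_at_filter, rule always_eventually, use eq in blast)
  then have q: "(q \<longlongrightarrow> A v) (at 0)"
    by (rule LIM_zero_cancel[OF tendsto_norm_zero_cancel])
  have "c * (norm (q t))\<^sup>2 \<le> q t \<bullet> v" if "t \<noteq> 0" for t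
  proof -
    have "c * (norm (q t))\<^sup>2 = (c * (norm (F (x + t *\<^sub>R v) - F x))\<^sup>2) / t\<^sup>2"
      by (simp add: q_def power_mult_distrib divide_simps)
    also have "\<dots> \<le> ((F (x + t *\<^sub>R v) - F x) \<bullet> (x + t *\<^sub>R v - x)) / t\<^sup>2"
      by (intro divide_right_mono mono) auto
    also have "\<dots> = q t \<bullet> v" using that by (simp add: q_def power2_eq_square divide_simps)
    finally show ?thesis .
  qed
  then have "eventually (\<lambda>t. c * (norm (q t))\<^sup>2 \<le> q t \<bullet> v) (at 0)"
    by (auto simp: eventually_at_filter)
  moreover have "((\<lambda>t. q t \<bullet> v) \<longlongrightarrow> A v \<bullet> v) (at 0)"
    "((\<lambda>t. c * (norm (q t))\<^sup>2) \<longlongrightarrow> c * (norm (A v))\<^sup>2) (at 0)"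
    by (intro tendsto_intros q)+
  ultimately show ?thesis using tendsto_le[OF trivial_limit_at] by blast
qed

subsection \<open>Proximal maps and gradients of convex functions\<close>

text \<open>Weierstrass' theorem for lower semicontinuous functions: the sublevel sets at the values
  attained on \<open>S\<close> have the finite intersection property, and a common point is a
  minimizer. Only the order on the values enters, so extended reals are covered.\<close>

lemma compact_attains_min_of_closed_sublevels:
  fixes \<psi> :: "'a::topological_space \<Rightarrow> 'b::linorder"
  assumes "compact S" "S \<noteq> {}" and cl: "\<And>r. closed {x. \<psi> x \<le> r}"
  shows "\<exists>x\<in>S. \<forall>y\<in>S. \<psi> x \<le> \<psi> y"
proof -
  let ?F = "(\<lambda>y. {x. \<psi> x \<le> \<psi> y}) ` S"
  have "S \<inter> \<Inter>?F \<noteq> {}"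
  proof (rule compact_imp_fip[OF \<open>compact S\<close>])
    show "closed T" if "T \<in> ?F" for T using that cl by auto
    show "S \<inter> \<Inter>F' \<noteq> {}" if F': "finite F'" "F' \<subseteq> ?F" for F'
    proof -
      obtain B where B: "B \<subseteq> S" "finite B" "F' = (\<lambda>y. {x. \<psi> x \<le> \<psi> y}) ` B"
        using finite_subset_image[OF F'] by blast
      show ?thesis
      proof (cases "B = {}")
        case False
        then have "Min (\<psi> ` B) \<in> \<psi> ` B" using B(2) by (intro Min_in) auto
        then obtain x where "x \<in> B" "Min (\<psi> ` B) = \<psi> x" by auto
        then have "x \<in> S" "\<forall>y\<in>B. \<psi> x \<le> \<psi> y" using B Min_le[of "\<psi> ` B"] by auto
        then show ?thesis using B(3) by auto
      qed (use B \<open>S \<noteq> {}\<close> in auto)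
    qed
  qed
  then show ?thesis by auto
qed

lemma Gamma0_closed_sublevel:
  fixes h :: "'a::real_normed_vector \<Rightarrow> ereal"
  assumes h: "h \<in> Gamma0" and q: "continuous_on UNIV q"
  shows "closed {x. h x + ereal (q x) \<le> r}"
proof (cases r)
  case (real r)
  have "open {x. ereal r < h x + ereal (q x)}"
  proof (subst open_subopen, safe)
    fix x assume x: "ereal r < h x + ereal (q x)"
    then have "ereal (r - q x) < h x" by (cases "h x") auto
    \<comment> \<open>A real number strictly between the two sides splits the strict inequality into
      \<open>h > a\<close> and \<open>q > r - a\<close>, each of which holds near
      \<open>x\<close>.\<close>
    then obtain a where a: "ereal (r - q x) < ereal a" "ereal a < h x"
      using ereal_dense2 by blast
    have "ereal a < Liminf (at x) h" using h a(2) by (auto simp: Gamma0_def intro: less_le_trans)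
    then have "eventually (\<lambda>y. ereal a < h y) (at x)" by (rule less_LiminfD)
    then have 1: "eventually (\<lambda>y. ereal a < h y) (nhds x)"
      using a(2) by (simp add: eventually_nhds_conv_at)
    have "isCont q x" using q by (simp add: continuous_on_eq_continuous_at)
    then have "(q \<longlongrightarrow> q x) (nhds x)" by (simp add: isCont_def tendsto_at_iff_tendsto_nhds)
    then have 2: "eventually (\<lambda>y. r - a < q y) (nhds x)"
      using a(1) by (intro order_tendstoD(1)) auto
    have "eventually (\<lambda>y. ereal r < h y + ereal (q y)) (nhds x)"
      using 1 2
    proof eventually_elim
      case (elim y)
      then show ?case by (cases "h y") auto
    qed
    then show "\<exists>T. open T \<and> x \<in> T \<and> T \<subseteq> {x. ereal r < h x + ereal (q x)}"
      by (auto simp: eventually_nhds)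
  qed
  moreover have "- {x. ereal r < h x + ereal (q x)} = {x. h x + ereal (q x) \<le> ereal r}" by auto
  ultimately show ?thesis unfolding real by (metis closed_open double_complement)
next
  case MInf
  have "{x. h x + ereal (q x) \<le> r} = {}"
    using h MInf by (auto simp: Gamma0_def)
  then show ?thesis by simp
qed simp

text \<open>A cheap substitute for an affine minorant. With \<open>c\<close> the minimum over the
  unit ball around \<open>x0\<close>, convexity along the ray from \<open>x0\<close> bounds the
  average descent beyond the sphere by \<open>h0 - c\<close> per unit length. A quadratic term
  dominates such a bound.\<close>

lemma Gamma0_norm_minorant:
  fixes h :: "'a::euclidean_space \<Rightarrow> ereal"
  assumes h: "h \<in> Gamma0"
  obtains x0 h0 c \<kappa> where "h x0 = ereal h0" "\<kappa> \<ge> 0" "\<And>x. ereal (c - \<kappa> * norm (x - x0)) \<le> h x"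
proof -
  obtain x0 where "h x0 \<noteq> \<infinity>" "h x0 \<noteq> -\<infinity>" using h by (auto simp: Gamma0_def)
  then obtain h0 where h0: "h x0 = ereal h0" by (cases "h x0") auto
  have "\<exists>x\<in>cball x0 1. \<forall>y\<in>cball x0 1. h x \<le> h y"
    using Gamma0_closed_sublevel[OF h, of "\<lambda>_. 0"]
    by (intro compact_attains_min_of_closed_sublevels) (auto simp: zero_ereal_def[symmetric])
  then obtain xm where xm: "\<And>y. y \<in> cball x0 1 \<Longrightarrow> h xm \<le> h y" by blast
  have "h xm \<le> ereal h0" using xm[of x0] h0 by simp
  moreover have "h xm \<noteq> -\<infinity>" using h by (auto simp: Gamma0_def)
  ultimately obtain c where c: "h xm = ereal c" by (cases "h xm") auto
  have c0: "c \<le> h0" using \<open>h xm \<le> ereal h0\<close> c by simp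
  have "ereal (c - (h0 - c) * norm (x - x0)) \<le> h x" for x
  proof (cases "norm (x - x0) \<le> 1")
    case True
    then have "ereal c \<le> h x" using xm[of x] c by (simp add: dist_norm norm_minus_commute)
    moreover have "(h0 - c) * norm (x - x0) \<ge> 0" using c0 by simp
    ultimately show ?thesis by (cases "h x") auto
  next
    case False
    define \<rho> where "\<rho> = norm (x - x0)"
    have \<rho>: "\<rho> > 1" using False by (simp add: \<rho>_def)
    \<comment> \<open>The point where the segment from \<open>x0\<close> to \<open>x\<close> crosses
      the unit sphere around \<open>x0\<close>.\<close>
    define p where "p = (1 - 1 / \<rho>) *\<^sub>R x0 + (1 / \<rho>) *\<^sub>R x"
    have "p - x0 = (1 / \<rho>) *\<^sub>R (x - x0)" by (simp add: p_def algebra_simps)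
    moreover have "x \<noteq> x0" using \<rho> by (auto simp: \<rho>_def)
    ultimately have "norm (p - x0) = 1" by (simp add: \<rho>_def)
    then have "ereal c \<le> h p" using xm[of p] c by (simp add: dist_norm norm_minus_commute)
    also have "h p \<le> ereal (1 - 1 / \<rho>) * h x0 + ereal (1 / \<rho>) * h x"
      using h \<rho> unfolding p_def Gamma0_def by auto
    finally have le: "ereal c \<le> ereal (1 - 1 / \<rho>) * ereal h0 + ereal (1 / \<rho>) * h x" by (simp add: h0)
    show ?thesis
    proof (cases "h x")
      case (real hx)
      have "c \<le> (1 - 1 / \<rho>) * h0 + 1 / \<rho> * hx" using le real by simp
      then have "\<rho> * c \<le> \<rho> * ((1 - 1 / \<rho>) * h0 + 1 / \<rho> * hx)" using \<rho> by simp
      also have "\<dots> = \<rho> * h0 - h0 + hx" using \<rho> by (simp add: field_simps)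
      finally have "c - (h0 - c) * \<rho> \<le> hx" using c0 by (simp add: algebra_simps)
      then show ?thesis by (simp add: real \<rho>_def)
    qed (use h in \<open>auto simp: Gamma0_def\<close>)
  qed
  then show ?thesis using that[of x0 h0 "h0 - c" c] h0 c0 by auto
qed

lemma prox_objective_has_min:
  fixes h :: "'a::euclidean_space \<Rightarrow> ereal"
  assumes h: "h \<in> Gamma0"
  shows "\<exists>p. p \<in> argmin_set (\<lambda>y. h y + ereal (1 / 2 * (norm (y - z))\<^sup>2))"
proof -
  obtain x0 h0 c \<kappa> where h0: "h x0 = ereal h0" and \<kappa>: "\<kappa> \<ge> 0"
    and minor: "\<And>x. ereal (c - \<kappa> * norm (x - x0)) \<le> h x"
    using Gamma0_norm_minorant[OF h] by metis
  define \<psi> where "\<psi> y = h y + ereal (1 / 2 * (norm (y - z))\<^sup>2)" for y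
  define b where "b = h0 + 1 / 2 * (norm (x0 - z))\<^sup>2 - c + \<kappa> * norm (z - x0)"
  \<comment> \<open>For s = |x - z| > R one has s/2 - \<kappa> \<ge> 1 and s > b, hence s^2/2 -
    \<kappa> s > b, which is what makes \<open>x\<close> worse than \<open>x0\<close>. The last
    summand places \<open>x0\<close> itself in the ball.\<close>
  define R where "R = 2 * \<kappa> + 2 + \<bar>b\<bar> + norm (z - x0)"
  have \<psi>0: "\<psi> x0 = ereal (h0 + 1 / 2 * (norm (x0 - z))\<^sup>2)" by (simp add: \<psi>_def h0)
  have far: "\<psi> x0 < \<psi> x" if "norm (x - z) > R" for x
  proof -
    define s where "s = norm (x - z)"
    have "norm (z - x0) \<ge> 0" by simp
    then have s: "s > 2 * \<kappa> + 2" "s > \<bar>b\<bar>" "s > 0"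
      using that \<kappa> unfolding s_def R_def by linarith+
    have "b < s * 1" using s by simp
    also have "\<dots> \<le> s * (s / 2 - \<kappa>)" using s by (intro mult_left_mono) auto
    finally have 1: "b < s\<^sup>2 / 2 - \<kappa> * s" by (simp add: power2_eq_square algebra_simps)
    have "norm (x - x0) \<le> s + norm (z - x0)" unfolding s_def using norm_triangle_ineq[of "x - z" "z - x0"] by simp
    then have "\<kappa> * norm (x - x0) \<le> \<kappa> * s + \<kappa> * norm (z - x0)"
      using mult_left_mono[OF _ \<kappa>] by (metis distrib_left)
    then have "h0 + 1 / 2 * (norm (x0 - z))\<^sup>2 < c - \<kappa> * norm (x - x0) + 1 / 2 * s\<^sup>2"
      using 1 by (simp add: b_def)
    then show ?thesis using minor[of x] unfolding \<psi>0 unfolding \<psi>_def s_def by (cases "h x") auto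
  qed
  have "0 \<le> R" using \<kappa> norm_ge_zero[of "z - x0"] unfolding R_def by linarith
  have "\<exists>x\<in>cball z R. \<forall>y\<in>cball z R. \<psi> x \<le> \<psi> y"
    unfolding \<psi>_def
    by (intro compact_attains_min_of_closed_sublevels Gamma0_closed_sublevel h continuous_intros)
      (use \<open>0 \<le> R\<close> in auto)
  then obtain p where p: "\<And>y. y \<in> cball z R \<Longrightarrow> \<psi> p \<le> \<psi> y" by blast
  have "\<psi> p \<le> \<psi> y" for y
  proof (cases "norm (y - z) > R")
    case True
    have "x0 \<in> cball z R" using \<kappa> unfolding R_def mem_cball dist_norm by linarith
    then show ?thesis using far[OF True] p[of x0] by simp
  qed (use p[of y] in \<open>simp add: dist_norm norm_minus_commute\<close>)
  then show ?thesis unfolding argmin_set_def \<psi>_def by blast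
qed

text \<open>The first-order condition that z - p is a subgradient of \<open>h\<close> at
  \<open>p\<close>: compare \<open>p\<close> with (1 - t) p + t y, use convexity, expand the square,
  divide by t and let t tend to 0.\<close>

lemma prox_objective_min_variational:
  fixes h :: "'a::euclidean_space \<Rightarrow> ereal"
  assumes h: "h \<in> Gamma0"
    and p: "p \<in> argmin_set (\<lambda>y. h y + ereal (1 / 2 * (norm (y - z))\<^sup>2))"
  shows "\<exists>k. h p = ereal k" "h p + ereal ((z - p) \<bullet> (y - p)) \<le> h y"
proof -
  have min: "h p + ereal (1 / 2 * (norm (p - z))\<^sup>2) \<le> h y + ereal (1 / 2 * (norm (y - z))\<^sup>2)" for y
    using p by (simp add: argmin_set_def)
  obtain x0 where x0: "h x0 \<noteq> \<infinity>" using h by (auto simp: Gamma0_def)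
  have nm: "h x \<noteq> -\<infinity>" for x using h by (auto simp: Gamma0_def)
  show "\<exists>k. h p = ereal k" using min[of x0] x0 nm[of p] nm[of x0] by (cases "h p"; cases "h x0") auto
  then obtain k where k: "h p = ereal k" by blast
  show "h p + ereal ((z - p) \<bullet> (y - p)) \<le> h y"
  proof (cases "h y")
    case (real l)
    have "k + (z - p) \<bullet> (y - p) \<le> l + t / 2 * (norm (y - p))\<^sup>2" if t: "0 < t" "t < 1" for t
    proof -
      let ?w = "(1 - t) *\<^sub>R p + t *\<^sub>R y"
      have "h ?w \<le> ereal (1 - t) * h p + ereal t * h y" using h t by (auto simp: Gamma0_def)
      then have "h ?w \<le> ereal ((1 - t) * k + t * l)" by (simp add: k real)
      moreover have "ereal k + ereal (1 / 2 * (norm (p - z))\<^sup>2) \<le> h ?w + ereal (1 / 2 * (norm (?w - z))\<^sup>2)"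
        using min[of ?w] by (simp add: k)
      ultimately have 1: "k + 1 / 2 * (norm (p - z))\<^sup>2 \<le> (1 - t) * k + t * l + 1 / 2 * (norm (?w - z))\<^sup>2"
        by (cases "h ?w") auto
      have E: "?w - z = (p - z) + t *\<^sub>R (y - p)" by (simp add: algebra_simps)
      have "(norm (a + t *\<^sub>R b))\<^sup>2 = (norm a)\<^sup>2 + 2 * t * (a \<bullet> b) + t\<^sup>2 * (norm b)\<^sup>2" for a b :: 'a
        by (simp add: power2_norm_eq_inner inner_add_left inner_add_right inner_commute power2_eq_square[of t] algebra_simps)
      then have "(norm (?w - z))\<^sup>2 = (norm (p - z))\<^sup>2 + 2 * t * ((p - z) \<bullet> (y - p)) + t\<^sup>2 * (norm (y - p))\<^sup>2"
        unfolding E by blast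
      then have "t * k \<le> t * (l + (p - z) \<bullet> (y - p) + t / 2 * (norm (y - p))\<^sup>2)"
        using 1 by (simp add: algebra_simps power2_eq_square)
      then have "k \<le> l + (p - z) \<bullet> (y - p) + t / 2 * (norm (y - p))\<^sup>2" using t by simp
      moreover have "(z - p) \<bullet> (y - p) = - ((p - z) \<bullet> (y - p))" by (simp add: inner_diff_left)
      ultimately show ?thesis by linarith
    qed
    then have "eventually (\<lambda>t. k + (z - p) \<bullet> (y - p) \<le> l + t / 2 * (norm (y - p))\<^sup>2) (at_right 0)"
      by (auto intro!: eventually_at_rightI[of 0 1])
    moreover have "((\<lambda>t. l + t / 2 * (norm (y - p))\<^sup>2) \<longlongrightarrow> l + 0 / 2 * (norm (y - p))\<^sup>2) (at_right 0)"
      by (intro tendsto_intros) auto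
    ultimately have "k + (z - p) \<bullet> (y - p) \<le> l"
      using tendsto_lowerbound by fastforce
    then show ?thesis by (simp add: k real)
  qed (use nm in auto)
qed

text \<open>Justifies the definite description in \<open>prox\<close>. Adding the variational
  inequalities of two minimizers gives |p - p'|^2 \<le> 0.\<close>

lemma prox_is_min:
  fixes h :: "'a::euclidean_space \<Rightarrow> ereal"
  assumes h: "h \<in> Gamma0"
  shows "prox h z \<in> argmin_set (\<lambda>y. h y + ereal (1 / 2 * (norm (y - z))\<^sup>2))"
proof -
  let ?A = "argmin_set (\<lambda>y. h y + ereal (1 / 2 * (norm (y - z))\<^sup>2))"
  have "p = p'" if pp: "p \<in> ?A" "p' \<in> ?A" for p p'
  proof -
    obtain k k' where k: "h p = ereal k" "h p' = ereal k'"
      using prox_objective_min_variational(1)[OF h pp(1)] prox_objective_min_variational(1)[OF h pp(2)] by blast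
    have "k + (z - p) \<bullet> (p' - p) \<le> k'" "k' + (z - p') \<bullet> (p - p') \<le> k"
      using prox_objective_min_variational(2)[OF h pp(1), of p']
        prox_objective_min_variational(2)[OF h pp(2), of p] k by auto
    then have "(p - p') \<bullet> (p - p') \<le> 0"
      by (simp add: inner_diff_left inner_diff_right inner_commute)
    then show ?thesis by (metis eq_iff_diff_eq_0 inner_eq_zero_iff inner_ge_zero order_antisym)
  qed
  then show ?thesis
    unfolding prox_def using prox_objective_has_min[OF h, of z] by (metis (no_types, lifting) the_equality)
qed

section \<open>Firm nonexpansiveness and the potential of the proximal map\<close>

lemma prox_variational:
  fixes h :: "'a::euclidean_space \<Rightarrow> ereal"
  assumes h: "h \<in> Gamma0"
  shows "real_of_ereal (h (prox h z)) + (z - prox h z) \<bullet> (prox h w - prox h z)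
    \<le> real_of_ereal (h (prox h w))"
proof -
  obtain k k' where "h (prox h z) = ereal k" "h (prox h w) = ereal k'"
    using prox_objective_min_variational(1)[OF h prox_is_min[OF h]] by blast
  then show ?thesis
    using prox_objective_min_variational(2)[OF h prox_is_min[OF h], of z "prox h w"] by simp
qed

lemma prox_firmly_nonexpansive:
  fixes h :: "'a::euclidean_space \<Rightarrow> ereal"
  assumes h: "h \<in> Gamma0"
  shows "(norm (prox h z - prox h w))\<^sup>2 \<le> (prox h z - prox h w) \<bullet> (z - w)"
proof -
  have "(z - a) \<bullet> (b - a) + (w - b) \<bullet> (a - b) = (norm (a - b))\<^sup>2 - (a - b) \<bullet> (z - w)" for a b
    by (simp add: power2_norm_eq_inner inner_diff_left inner_diff_right inner_commute algebra_simps)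
  from this[of "prox h z" "prox h w"] show ?thesis
    using prox_variational[OF h, of z w] prox_variational[OF h, of w z] by linarith
qed

text \<open>The proximal map is the gradient of the Legendre conjugate of \<open>h + \<parallel>\<cdot>\<parallel>\<^sup>2 / 2\<close>,
  which is what makes its derivatives symmetric.\<close>

lemma prox_eq_gradient:
  fixes h :: "'a::euclidean_space \<Rightarrow> ereal"
  assumes h: "h \<in> Gamma0"
  defines "\<phi> \<equiv> \<lambda>z. z \<bullet> prox h z - real_of_ereal (h (prox h z)) - 1 / 2 * (norm (prox h z))\<^sup>2"
  shows "GDERIV \<phi> z :> prox h z"
proof -
  \<comment> \<open>\<open>prox h z\<close> is a subgradient of the potential at \<open>z\<close>:
    it attains the supremum that defines the conjugate.\<close>
  have low: "\<phi> z + (w - z) \<bullet> prox h z \<le> \<phi> w" for z w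
  proof -
    have "(w - prox h w) \<bullet> (prox h z - prox h w) + real_of_ereal (h (prox h w)) \<le> real_of_ereal (h (prox h z))"
      using prox_variational[OF h, of w z] by simp
    moreover have "0 \<le> (prox h z - prox h w) \<bullet> (prox h z - prox h w)" by simp
    ultimately show ?thesis
      unfolding \<phi>_def
      by (simp add: power2_norm_eq_inner inner_diff_left inner_diff_right inner_commute field_simps)
  qed
  \<comment> \<open>The subgradient inequalities at \<open>z\<close> and at \<open>w\<close> enclose
    the remainder between 0 and (w - z) . (prox w - prox z), which is at most |w - z|^2 because prox
    is nonexpansive. A quadratic remainder gives differentiability, with the radius \<open>e\<close>
    itself as the admissible \<open>d\<close>.\<close>
  have bd: "norm (\<phi> w - \<phi> z - (w - z) \<bullet> prox h z) \<le> norm (w - z) * norm (w - z)" for w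
  proof -
    have fn: "(norm (prox h w - prox h z))\<^sup>2 \<le> norm (prox h w - prox h z) * norm (w - z)"
      using prox_firmly_nonexpansive[OF h, of w z] norm_cauchy_schwarz order_trans by blast
    then have ne: "norm (prox h w - prox h z) \<le> norm (w - z)"
      by (cases "prox h w = prox h z") (auto simp: power2_eq_square)
    have "\<phi> w - \<phi> z - (w - z) \<bullet> prox h z \<le> (w - z) \<bullet> (prox h w - prox h z)"
      using low[of w z] by (simp add: inner_diff_left inner_diff_right)
    also have "\<dots> \<le> norm (w - z) * norm (prox h w - prox h z)" by (rule norm_cauchy_schwarz)
    also have "\<dots> \<le> norm (w - z) * norm (w - z)" using ne by (intro mult_left_mono) auto
    finally show ?thesis using low[of z w] by simp
  qed
  show ?thesis
    unfolding gderiv_def has_derivative_at_alt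
  proof (intro conjI allI impI)
    show "bounded_linear (\<lambda>u. u \<bullet> prox h z)" by (rule bounded_linear_inner_left)
    fix e :: real assume "e > 0"
    have "norm (\<phi> y - \<phi> z - (y - z) \<bullet> prox h z) \<le> e * norm (y - z)" if "norm (y - z) < e" for y
      using bd[of y] mult_right_mono[of "norm (y - z)" e "norm (y - z)"] that by (meson less_imp_le norm_ge_zero order_trans)
    then show "\<exists>d>0. \<forall>y. norm (y - z) < d \<longrightarrow> norm (\<phi> y - \<phi> z - (y - z) \<bullet> prox h z) \<le> e * norm (y - z)"
      using \<open>e > 0\<close> by blast
  qed
qed

text \<open>\<open>prox_map\<close> applies \<open>prox\<close> to \<gamma> g, so the class has to
  be stable under positive factors. Lower semicontinuity is moved across the factor by dividing the
  threshold \<open>r\<close>.\<close>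

lemma Gamma0_scale:
  fixes h :: "'a::real_normed_vector \<Rightarrow> ereal"
  assumes h: "h \<in> Gamma0" and "c > 0"
  shows "(\<lambda>x. ereal c * h x) \<in> Gamma0"
proof -
  have 1: "ereal c * h x \<noteq> -\<infinity>" for x
    using h \<open>c > 0\<close> by (cases "h x") (auto simp: Gamma0_def)
  obtain x0 where "h x0 \<noteq> \<infinity>" "h x0 \<noteq> -\<infinity>" using h by (auto simp: Gamma0_def)
  then have 2: "ereal c * h x0 \<noteq> \<infinity>" by (cases "h x0") auto
  have 3: "ereal c * h x \<le> Liminf (at x) (\<lambda>x. ereal c * h x)" for x
    unfolding le_Liminf_iff
  proof (intro allI impI)
    fix r assume r: "r < ereal c * h x"
    have "r / ereal c < h x"
      using r \<open>c > 0\<close> by (simp add: ereal_divide_less_iff mult.commute)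
    also have "h x \<le> Liminf (at x) h" using h by (auto simp: Gamma0_def)
    finally have "eventually (\<lambda>y. r / ereal c < h y) (at x)" by (rule less_LiminfD)
    then show "eventually (\<lambda>y. r < ereal c * h y) (at x)"
      using \<open>c > 0\<close> by (simp add: ereal_divide_less_iff mult.commute)
  qed
  have 4: "ereal c * h ((1 - t) *\<^sub>R x + t *\<^sub>R y) \<le> ereal (1 - t) * (ereal c * h x) + ereal t * (ereal c * h y)"
    if t: "0 < t" "t < 1" for x y t
  proof -
    have "h ((1 - t) *\<^sub>R x + t *\<^sub>R y) \<le> ereal (1 - t) * h x + ereal t * h y"
      using h t by (auto simp: Gamma0_def)
    then have "ereal c * h ((1 - t) *\<^sub>R x + t *\<^sub>R y) \<le> ereal c * (ereal (1 - t) * h x + ereal t * h y)"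
      using \<open>c > 0\<close> by (intro ereal_mult_left_mono) auto
    also have "\<dots> = ereal (1 - t) * (ereal c * h x) + ereal t * (ereal c * h y)"
      using h t \<open>c > 0\<close> by (cases "h x"; cases "h y") (auto simp: Gamma0_def algebra_simps)
    finally show ?thesis .
  qed
  show ?thesis using 1 2 3 4 unfolding Gamma0_def by blast
qed

text \<open>By convexity the secant slopes from \<open>x\<close> towards \<open>y\<close> are at
  most \<open>h y - h x\<close>; their limit from the right is the directional derivative.\<close>

lemma convex_gradient_inequality:
  fixes h :: "'a::real_inner \<Rightarrow> real"
  assumes h: "(\<lambda>x. ereal (h x)) \<in> Gamma0" and d: "GDERIV h x :> v"
  shows "h x + (y - x) \<bullet> v \<le> h y"
proof -
  have "(h has_derivative (\<lambda>u. u \<bullet> v)) (at (x + 0 *\<^sub>R (y - x)))" using d by (simp add: gderiv_def)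
  then have "((\<lambda>t. h (x + t *\<^sub>R (y - x))) has_derivative (\<lambda>t. (t *\<^sub>R (y - x)) \<bullet> v)) (at 0)"
    by (intro has_derivative_compose[of "\<lambda>s. x + s *\<^sub>R (y - x)" "\<lambda>s. s *\<^sub>R (y - x)" 0 UNIV h, simplified])
      (auto intro!: derivative_eq_intros)
  then have "((\<lambda>t. h (x + t *\<^sub>R (y - x))) has_real_derivative ((y - x) \<bullet> v)) (at 0)"
    by (simp add: has_field_derivative_def mult_commute_abs)
  then have "((\<lambda>t. (h (x + t *\<^sub>R (y - x)) - h x) / t) \<longlongrightarrow> (y - x) \<bullet> v) (at 0)"
    by (simp add: DERIV_def)
  then have lim: "((\<lambda>t. (h (x + t *\<^sub>R (y - x)) - h x) / t) \<longlongrightarrow> (y - x) \<bullet> v) (at_right 0)"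
    by (rule filterlim_mono) (auto simp: at_le)
  have "(h (x + t *\<^sub>R (y - x)) - h x) / t \<le> h y - h x" if t: "0 < t" "t < 1" for t
  proof -
    have "ereal (h ((1 - t) *\<^sub>R x + t *\<^sub>R y)) \<le> ereal (1 - t) * ereal (h x) + ereal t * ereal (h y)"
      using h t unfolding Gamma0_def by blast
    then have "h ((1 - t) *\<^sub>R x + t *\<^sub>R y) \<le> (1 - t) * h x + t * h y" by simp
    moreover have "(1 - t) *\<^sub>R x + t *\<^sub>R y = x + t *\<^sub>R (y - x)" by (simp add: algebra_simps)
    ultimately show ?thesis using t by (simp add: field_simps)
  qed
  then have "eventually (\<lambda>t. (h (x + t *\<^sub>R (y - x)) - h x) / t \<le> h y - h x) (at_right 0)"
    by (auto intro!: eventually_at_rightI[of 0 1])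
  then have "(y - x) \<bullet> v \<le> h y - h x"
    using tendsto_upperbound[OF lim] by simp
  then show ?thesis by simp
qed

lemma C11_gderiv_grad:
  assumes "h \<in> C11"
  shows "GDERIV h x :> grad h x"
proof -
  obtain d where d: "GDERIV h x :> d" using assms by (auto simp: C11_def)
  have "d' = d" if "GDERIV h x :> d'" for d'
  proof -
    have "(\<lambda>u. u \<bullet> d') = (\<lambda>u. u \<bullet> d)"
      using that d unfolding gderiv_def by (rule has_derivative_unique)
    then show ?thesis by (metis vector_eq_ldot)
  qed
  then show ?thesis unfolding grad_def using d by (metis theI)
qed

lemma convex_C11_grad_monotone:
  assumes "h \<in> C11" "(\<lambda>x. ereal (h x)) \<in> Gamma0"
  shows "0 \<le> (grad h x - grad h y) \<bullet> (x - y)"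
proof -
  have "h x + (y - x) \<bullet> grad h x \<le> h y" "h y + (x - y) \<bullet> grad h y \<le> h x"
    by (intro convex_gradient_inequality assms C11_gderiv_grad)+
  moreover have "(y - x) \<bullet> u + (x - y) \<bullet> v = - ((u - v) \<bullet> (x - y))" for u v
    by (simp add: inner_diff_left inner_diff_right inner_commute)
  ultimately show ?thesis by (smt (verit))
qed

subsection \<open>Clarke Jacobians\<close>

lemma symmetric_dot:
  fixes A :: "real^'n^'n"
  assumes "transpose A = A"
  shows "(A *v x) \<bullet> y = x \<bullet> (A *v y)"
  by (subst (1) assms[symmetric]) (simp add: dot_lmul_matrix)

lemma dot_imp_symmetric:
  fixes A :: "real^'n^'n"
  assumes "\<And>x y. (A *v x) \<bullet> y = x \<bullet> (A *v y)"
  shows "transpose A = A"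
proof -
  have "(transpose A *v v) \<bullet> u = (A *v v) \<bullet> u" for u v
    by (simp add: transpose_matrix_vector dot_lmul_matrix assms)
  then have "transpose A *v v = A *v v" for v by (metis vector_eq_rdot)
  then show ?thesis by (simp add: matrix_eq)
qed

lemma block_row_apply: "blinfun_apply (block_row Q P) (u, v) = Q *v u + P *v v"
proof -
  have "bounded_linear (\<lambda>x. Q *v fst x + P *v snd x)"
    by (intro bounded_linear_add bounded_linear_compose[OF matrix_vector_mul_bounded_linear]
        bounded_linear_fst bounded_linear_snd)
  then show ?thesis by (simp add: block_row_def case_prod_beta' bounded_linear_Blinfun_apply)
qed

text \<open>The Clarke Jacobian is a convex hull, so a property of limiting derivatives survives
  only if it cuts out a convex set. This one does since its left side is convex and its right side
  linear in the operator.\<close>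

lemma convex_cocoercive_operators:
  fixes c :: real
  assumes "c \<ge> 0"
  shows "convex {A :: ('a::real_inner \<times> 'b::real_normed_vector) \<Rightarrow>\<^sub>L 'a. c * (norm (A (u, 0)))\<^sup>2 \<le> A (u, 0) \<bullet> u}"
proof (rule convexI, simp)
  fix A B :: "('a \<times> 'b) \<Rightarrow>\<^sub>L 'a" and s t :: real
  assume A: "c * (norm (A (u, 0)))\<^sup>2 \<le> A (u, 0) \<bullet> u" and B: "c * (norm (B (u, 0)))\<^sup>2 \<le> B (u, 0) \<bullet> u"
    and st: "0 \<le> s" "0 \<le> t" "s + t = 1"
  define a b where "a = A (u, 0)" and "b = B (u, 0)"
  have t: "t = 1 - s" using st by simp
  have "(norm (s *\<^sub>R a + t *\<^sub>R b))\<^sup>2 = s * (norm a)\<^sup>2 + t * (norm b)\<^sup>2 - s * t * (norm (a - b))\<^sup>2"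
    unfolding t by (simp add: power2_norm_eq_inner inner_add_left inner_add_right inner_diff_left inner_diff_right inner_commute algebra_simps)
  then have "(norm (s *\<^sub>R a + t *\<^sub>R b))\<^sup>2 \<le> s * (norm a)\<^sup>2 + t * (norm b)\<^sup>2" using st by simp
  then have "c * (norm (s *\<^sub>R a + t *\<^sub>R b))\<^sup>2 \<le> c * (s * (norm a)\<^sup>2 + t * (norm b)\<^sup>2)"
    using \<open>c \<ge> 0\<close> by (rule mult_left_mono)
  also have "\<dots> = s * (c * (norm a)\<^sup>2) + t * (c * (norm b)\<^sup>2)" by (simp add: algebra_simps)
  also have "\<dots> \<le> s * (a \<bullet> u) + t * (b \<bullet> u)"
    using A B st by (intro add_mono mult_left_mono) (auto simp: a_def b_def)
  finally show "c * (norm (blinfun_apply (s *\<^sub>R A + t *\<^sub>R B) (u, 0)))\<^sup>2 \<le> blinfun_apply (s *\<^sub>R A + t *\<^sub>R B) (u, 0) \<bullet> u"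
    by (simp add: a_def b_def blinfun.add_left blinfun.scaleR_left inner_add_left)
qed

text \<open>By minimality of the hull it suffices to treat limits of classical derivatives. At each
  approximating point the joint map is restricted to the slice with that point's own parameter,
  whose derivative is the first block. These parameters differ from \<theta> but eventually lie in
  the open set \<O>, which is why \<open>sym\<close> and \<open>mono\<close> are required on all of
  \<O>.\<close>

lemma clarke_block_symmetric_cocoercive:
  fixes F :: "(real^'n) \<times> (real^'m) \<Rightarrow> real^'n"
  assumes Q: "block_row Q P \<in> clarke_jacobian F (x, \<theta>)" and O: "open \<O>" "\<theta> \<in> \<O>" and c: "c \<ge> 0"
    and sym: "\<And>\<theta> z A u v. \<theta> \<in> \<O> \<Longrightarrow> ((\<lambda>z. F (z, \<theta>)) has_derivative A) (at z) \<Longrightarrow> A u \<bullet> v = u \<bullet> A v"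
    and mono: "\<And>\<theta> y z. \<theta> \<in> \<O> \<Longrightarrow> c * (norm (F (y, \<theta>) - F (z, \<theta>)))\<^sup>2 \<le> (F (y, \<theta>) - F (z, \<theta>)) \<bullet> (y - z)"
  shows "transpose Q = Q" "\<And>u. c * (norm (Q *v u))\<^sup>2 \<le> (Q *v u) \<bullet> u"
proof -
  define X where "X = (\<Inter>u v. {A :: ((real^'n) \<times> (real^'m)) \<Rightarrow>\<^sub>L (real^'n). A (u, 0) \<bullet> v = u \<bullet> A (v, 0)}) \<inter>
    (\<Inter>u. {A :: ((real^'n) \<times> (real^'m)) \<Rightarrow>\<^sub>L (real^'n). c * (norm (A (u, 0)))\<^sup>2 \<le> A (u, 0) \<bullet> u})"
  have "convex {A :: ((real^'n) \<times> (real^'m)) \<Rightarrow>\<^sub>L (real^'n). A (u, 0) \<bullet> v = u \<bullet> A (v, 0)}" for u v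
    by (rule convexI) (simp add: blinfun.add_left blinfun.scaleR_left inner_add_left inner_add_right)
  then have "convex X" unfolding X_def
    by (intro convex_Int convex_INT convex_cocoercive_operators c) auto
  moreover have "{A. \<exists>q B. q \<longlonglongrightarrow> (x, \<theta>) \<and> (\<forall>j. (F has_derivative blinfun_apply (B j)) (at (q j))) \<and> B \<longlonglongrightarrow> A} \<subseteq> X"
  proof safe
    fix A q B assume q: "q \<longlonglongrightarrow> (x, \<theta>)" and B: "\<forall>j. (F has_derivative blinfun_apply (B j)) (at (q j))" "B \<longlonglongrightarrow> A"
    have "(\<lambda>j. snd (q j)) \<longlonglongrightarrow> \<theta>" using tendsto_snd[OF q] by simp
    then have ev: "eventually (\<lambda>j. snd (q j) \<in> \<O>) sequentially" using O by (rule topological_tendstoD)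
    have d: "((\<lambda>z. F (z, snd (q j))) has_derivative (\<lambda>u. B j (u, 0))) (at (fst (q j)))" for j
    proof -
      have "(F has_derivative blinfun_apply (B j)) (at (fst (q j), snd (q j)))" using B(1) by simp
      then show ?thesis
        by (intro has_derivative_compose[of "\<lambda>z. (z, snd (q j))" "\<lambda>u. (u, 0)" "fst (q j)" UNIV F, simplified])
          (auto intro!: derivative_eq_intros)
    qed
    have lim: "(\<lambda>j. B j (u, 0)) \<longlonglongrightarrow> A (u, 0)" for u by (intro tendsto_intros B(2))
    have "A (u, 0) \<bullet> v = u \<bullet> A (v, 0)" for u v
    proof (rule LIMSEQ_unique)
      show "(\<lambda>j. B j (u, 0) \<bullet> v) \<longlonglongrightarrow> A (u, 0) \<bullet> v" by (intro tendsto_intros lim)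
      have "(\<lambda>j. u \<bullet> B j (v, 0)) \<longlonglongrightarrow> u \<bullet> A (v, 0)" by (intro tendsto_intros lim)
      then show "(\<lambda>j. B j (u, 0) \<bullet> v) \<longlonglongrightarrow> u \<bullet> A (v, 0)"
        by (rule Lim_transform_eventually) (use ev in eventually_elim, use sym[OF _ d] in simp)
    qed
    moreover have "c * (norm (A (u, 0)))\<^sup>2 \<le> A (u, 0) \<bullet> u" for u
    proof (rule tendsto_le[OF trivial_limit_sequentially])
      show "(\<lambda>j. B j (u, 0) \<bullet> u) \<longlonglongrightarrow> A (u, 0) \<bullet> u"
        "(\<lambda>j. c * (norm (B j (u, 0)))\<^sup>2) \<longlonglongrightarrow> c * (norm (A (u, 0)))\<^sup>2" by (intro tendsto_intros lim)+
      show "eventually (\<lambda>j. c * (norm (B j (u, 0)))\<^sup>2 \<le> B j (u, 0) \<bullet> u) sequentially"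
        using ev by eventually_elim (rule cocoercive_derivative[OF mono d])
    qed
    ultimately show "A \<in> X" by (simp add: X_def)
  qed
  ultimately have "block_row Q P \<in> X" using Q hull_minimal unfolding clarke_jacobian_def by blast
  then have s: "(Q *v u) \<bullet> v = u \<bullet> (Q *v v)" and "c * (norm (Q *v u))\<^sup>2 \<le> (Q *v u) \<bullet> u" for u v
    by (auto simp: X_def block_row_apply)
  then show "\<And>u. c * (norm (Q *v u))\<^sup>2 \<le> (Q *v u) \<bullet> u" by blast
  show "transpose Q = Q" by (rule dot_imp_symmetric) (rule s)
qed

lemma D_set_symmetric_psd:
  fixes f :: "real^'n \<Rightarrow> real^'m \<Rightarrow> real"
  assumes reg: "composite_regularity \<O> f g L \<epsilon>\<^sub>b \<gamma>" and O: "open \<O>" "\<theta> \<in> \<O>"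
    and D: "(Q, P, H, M) \<in> D_set f g \<gamma> \<epsilon> x \<theta>"
  shows "transpose Q = Q" "\<And>u. (norm (Q *v u))\<^sup>2 \<le> (Q *v u) \<bullet> u"
    "transpose H = H" "\<And>u. 0 \<le> (H *v u) \<bullet> u"
proof -
  have \<gamma>: "\<gamma> > 0" using reg by (simp add: composite_regularity_def)
  have f: "(\<lambda>x. f x \<theta>) \<in> C11" "(\<lambda>x. ereal (f x \<theta>)) \<in> Gamma0"
    and g: "(\<lambda>x. ereal \<gamma> * g x \<theta>) \<in> Gamma0" if "\<theta> \<in> \<O>" for \<theta>
    using reg that Gamma0_scale[OF _ \<gamma>] by (auto simp: composite_regularity_def)
  have QP: "block_row Q P \<in> clarke_jacobian (prox_map \<gamma> g) (z_eps f \<gamma> \<epsilon> x \<theta>, \<theta>)"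
    and HM: "block_row H M \<in> clarke_jacobian (grad_x f) (x, \<theta>)"
    using D by (auto simp: D_set_def)
  have sym1: "A u \<bullet> v = u \<bullet> A v"
    if "\<theta> \<in> \<O>" "((\<lambda>z. prox_map \<gamma> g (z, \<theta>)) has_derivative A) (at z)" for \<theta> z A u v
    using gderiv_second_derivative_symmetric[OF prox_eq_gradient[OF g]] that by (simp add: prox_map_def)
  have sym2: "A u \<bullet> v = u \<bullet> A v"
    if "\<theta> \<in> \<O>" "((\<lambda>z. grad_x f (z, \<theta>)) has_derivative A) (at z)" for \<theta> z A u v
    using gderiv_second_derivative_symmetric[OF C11_gderiv_grad[OF f(1)]] that by (simp add: grad_x_def)
  note 1 = clarke_block_symmetric_cocoercive[OF QP O, of 1, OF _ sym1]
  note 2 = clarke_block_symmetric_cocoercive[OF HM O, of 0, OF _ sym2]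
  show "transpose Q = Q" "(norm (Q *v u))\<^sup>2 \<le> (Q *v u) \<bullet> u" for u
    using 1 by (auto simp: prox_map_def prox_firmly_nonexpansive[OF g])
  show "transpose H = H" "0 \<le> (H *v u) \<bullet> u" for u
    using 2 by (auto simp: grad_x_def convex_C11_grad_monotone[OF f])
qed

subsection \<open>Matrix limits\<close>

lemma tendsto_matrix_mult:
  fixes A :: "'k \<Rightarrow> real^'n^'m" and B :: "'k \<Rightarrow> real^'p^'n"
  assumes "(A \<longlongrightarrow> a) F" "(B \<longlongrightarrow> b) F"
  shows "((\<lambda>k. A k ** B k) \<longlongrightarrow> a ** b) F"
  unfolding matrix_matrix_mult_def
  by (intro vec_tendstoI) (simp add: tendsto_sum tendsto_mult tendsto_vec_nth assms)

lemma tendsto_matrix_vector_mult: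
  fixes A :: "'k \<Rightarrow> real^'n^'m"
  assumes "(A \<longlongrightarrow> a) F" "(x \<longlongrightarrow> y) F"
  shows "((\<lambda>k. A k *v x k) \<longlongrightarrow> a *v y) F"
  unfolding matrix_vector_mult_def
  by (intro vec_tendstoI) (simp add: tendsto_sum tendsto_mult tendsto_vec_nth assms)

lemma tendsto_transpose:
  fixes A :: "'k \<Rightarrow> real^'n^'m"
  assumes "(A \<longlongrightarrow> a) F"
  shows "((\<lambda>k. transpose (A k)) \<longlongrightarrow> transpose a) F"
  unfolding transpose_def by (intro vec_tendstoI) (simp add: tendsto_vec_nth assms)

text \<open>Turns the subsequential limits obtained from compactness of eigenbases into limits of
  the whole sequence.\<close>

lemma tendsto_of_subsequences:
  fixes X :: "nat \<Rightarrow> 'a::metric_space"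
  assumes "\<And>r :: nat \<Rightarrow> nat. strict_mono r \<Longrightarrow> \<exists>s :: nat \<Rightarrow> nat. strict_mono s \<and> (\<lambda>k. X (r (s k))) \<longlonglongrightarrow> L"
  shows "X \<longlonglongrightarrow> L"
proof (rule ccontr)
  assume "\<not> X \<longlonglongrightarrow> L"
  then obtain e where e: "e > 0" "\<not> eventually (\<lambda>k. dist (X k) L < e) sequentially"
    by (auto simp: tendsto_iff)
  then have inf: "infinite {k. \<not> dist (X k) L < e}"
    by (auto simp: eventually_cofinite cofinite_eq_sequentially[symmetric])
  define r where "r = enumerate {k. \<not> dist (X k) L < e}"
  have r: "strict_mono r" "\<And>k. \<not> dist (X (r k)) L < e"
    using strict_mono_enumerate[OF inf] enumerate_in_set[OF inf] by (auto simp: r_def)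
  from assms[OF r(1)] obtain s where "(\<lambda>k. X (r (s k))) \<longlonglongrightarrow> L" by blast
  then have "eventually (\<lambda>k. dist (X (r (s k))) L < e) sequentially" using e(1) by (rule tendstoD)
  then show False using r(2) by (auto simp: eventually_sequentially)
qed

subsection \<open>Spectral decomposition of symmetric matrices\<close>

text \<open>A maximizer \<open>v\<close> of the quadratic form on the unit sphere of
  \<open>S\<close> is an eigenvector: B = l I - A is positive semidefinite on \<open>S\<close> and
  its form vanishes at \<open>v\<close>, which forces B v = 0. To see this, the form is evaluated at
  v + t B v.\<close>

lemma symmetric_eigenvector_in_subspace:
  fixes A :: "real^'n^'n"
  assumes A: "transpose A = A" and S: "subspace S" "\<And>x. x \<in> S \<Longrightarrow> A *v x \<in> S" and z: "z \<in> S" "z \<noteq> 0"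
  obtains v l where "v \<in> S" "norm v = 1" "A *v v = l *\<^sub>R v"
proof -
  let ?K = "S \<inter> sphere 0 1"
  have "(1 / norm z) *\<^sub>R z \<in> ?K" using S(1) z by (simp add: subspace_scale)
  then have ne: "?K \<noteq> {}" by blast
  have "compact ?K" using closed_subspace[OF S(1)] by (intro closed_Int_compact) auto
  moreover have "continuous_on ?K (\<lambda>y. (A *v y) \<bullet> y)"
    by (intro continuous_intros linear_continuous_on matrix_vector_mul_bounded_linear)
  ultimately obtain v where v: "v \<in> ?K" and max: "\<And>y. y \<in> ?K \<Longrightarrow> (A *v y) \<bullet> y \<le> (A *v v) \<bullet> v"
    using continuous_attains_sup[OF _ ne] by blast
  define l where "l = (A *v v) \<bullet> v"
  have vS: "v \<in> S" and nv: "norm v = 1" using v by auto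
  define B where "B w = l *\<^sub>R w - A *v w" for w
  have Bpos: "0 \<le> B w \<bullet> w" if "w \<in> S" for w
  proof (cases "w = 0")
    case False
    have "(1 / norm w) *\<^sub>R w \<in> ?K" using S(1) that False by (simp add: subspace_scale)
    from max[OF this] have "((A *v w) \<bullet> w) / (norm w)\<^sup>2 \<le> l"
      by (simp add: l_def matrix_vector_mult_scaleR power2_eq_square)
    then have "(A *v w) \<bullet> w \<le> l * (norm w)\<^sup>2" using False by (simp add: divide_simps)
    then show ?thesis by (simp add: B_def inner_diff_left power2_norm_eq_inner)
  qed (simp add: B_def)
  have Bv: "B v \<bullet> v = 0" using nv by (simp add: B_def l_def inner_diff_left norm_eq_1)
  define w where "w = B v"
  have wS: "w \<in> S" unfolding w_def B_def using S vS by (simp add: subspace_diff subspace_scale)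
  have sym: "B x \<bullet> y = x \<bullet> B y" for x y
    by (simp add: B_def inner_diff_left inner_diff_right symmetric_dot[OF A])
  have lin: "B (x + t *\<^sub>R y) = B x + t *\<^sub>R B y" for x y t
    by (simp add: B_def algebra_simps)
  have quad: "0 \<le> 2 * t * (w \<bullet> w) + t\<^sup>2 * (B w \<bullet> w)" for t
  proof -
    have "0 \<le> B (v + t *\<^sub>R w) \<bullet> (v + t *\<^sub>R w)" using Bpos S(1) vS wS by (simp add: subspace_add subspace_scale)
    also have "\<dots> = B v \<bullet> v + t * (B v \<bullet> w) + t * (B w \<bullet> v) + t\<^sup>2 * (B w \<bullet> w)"
      by (simp add: lin inner_add_left inner_add_right power2_eq_square algebra_simps)
    also have "B w \<bullet> v = w \<bullet> w" by (simp add: sym w_def)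
    finally show ?thesis using Bv by (simp add: w_def)
  qed
  define b where "b = B w \<bullet> w"
  have b: "b \<ge> 0" using Bpos[OF wS] by (simp add: b_def)
  \<comment> \<open>The minimizing t would be -(w . w)/b; the denominator \<open>b + 1\<close> also
    covers b = 0 and still makes the expression negative unless w = 0.\<close>
  have "0 \<le> 2 * (- (w \<bullet> w) / (b + 1)) * (w \<bullet> w) + (- (w \<bullet> w) / (b + 1))\<^sup>2 * b"
    using quad unfolding b_def .
  also have "\<dots> = - ((w \<bullet> w)\<^sup>2 * (b + 2) / (b + 1)\<^sup>2)"
    using b by (simp add: divide_simps power2_eq_square) (simp add: algebra_simps)
  finally have "(w \<bullet> w)\<^sup>2 * (b + 2) \<le> 0" using b by (simp add: divide_le_0_iff)
  then have "w \<bullet> w = 0" using b by (auto simp: mult_le_0_iff)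
  then have "A *v v = l *\<^sub>R v" by (simp add: w_def B_def)
  then show ?thesis using that vS nv by blast
qed

text \<open>The eigenvectors are the rows of \<open>U\<close>, so that \<open>A = U\<^sup>T diag(l) U\<close>.\<close>

definition eigensystem :: "real^'n^'n \<Rightarrow> real^'n^'n \<Rightarrow> real^'n \<Rightarrow> bool" where
  "eigensystem A U l \<longleftrightarrow> (\<forall>i j. U $ i \<bullet> U $ j = (if i = j then 1 else 0)) \<and> (\<forall>i. A *v (U $ i) = l $ i *\<^sub>R U $ i)"

text \<open>Induction on the number of eigenvectors: the orthogonal complement of those already
  found is invariant because \<open>A\<close> is symmetric, and nonzero as long as fewer than n have
  been found.\<close>

lemma symmetric_orthonormal_eigenvectors:
  fixes A :: "real^'n^'n"
  assumes A: "transpose A = A" and "k \<le> CARD('n)"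
  shows "\<exists>B. finite B \<and> card B = k \<and> pairwise orthogonal B \<and> (\<forall>b\<in>B. norm b = 1 \<and> (\<exists>l. A *v b = l *\<^sub>R b))"
  using assms(2)
proof (induction k)
  case (Suc k)
  then obtain B where B: "finite B" "card B = k" "pairwise orthogonal B"
    "\<And>b. b \<in> B \<Longrightarrow> norm b = 1 \<and> (\<exists>l. A *v b = l *\<^sub>R b)" by force
  let ?S = "{x. \<forall>b\<in>B. x \<bullet> b = 0}"
  have "dim B < DIM(real^'n)" using dim_le_card'[OF B(1)] B(2) Suc.prems by simp
  then obtain z where z: "z \<noteq> 0" "\<And>y. y \<in> span B \<Longrightarrow> orthogonal z y"
    by (rule orthogonal_to_subspace_exists) blast
  then have zS: "z \<in> ?S" by (auto simp: orthogonal_def span_base)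
  have S: "subspace ?S" by (auto simp: subspace_def inner_add_left)
  have inv: "A *v x \<in> ?S" if "x \<in> ?S" for x
  proof -
    have "(A *v x) \<bullet> b = 0" if b: "b \<in> B" for b
    proof -
      obtain l where "A *v b = l *\<^sub>R b" using B(4)[OF b] by blast
      then show ?thesis using \<open>x \<in> ?S\<close> b by (simp add: symmetric_dot[OF A])
    qed
    then show ?thesis by blast
  qed
  obtain v l where v: "v \<in> ?S" "norm v = 1" "A *v v = l *\<^sub>R v"
    by (rule symmetric_eigenvector_in_subspace[OF A S inv zS z(1)])
  have "v \<notin> B" using v by (auto simp: norm_eq_1)
  moreover have "pairwise orthogonal (insert v B)"
    using B(3) v(1) by (auto simp: pairwise_insert orthogonal_def inner_commute)
  ultimately show ?case using B v by (intro exI[of _ "insert v B"]) auto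
qed (intro exI[of _ "{}"], simp)

lemma eigensystem_exists:
  fixes A :: "real^'n^'n"
  assumes A: "transpose A = A"
  obtains U l where "eigensystem A U l"
proof -
  obtain B where B: "finite B" "card B = CARD('n)" "pairwise orthogonal B"
    "\<And>b. b \<in> B \<Longrightarrow> norm b = 1 \<and> (\<exists>l. A *v b = l *\<^sub>R b)"
    using symmetric_orthonormal_eigenvectors[OF A order_refl] by blast
  obtain e where e: "bij_betw e (UNIV::'n set) B"
    using B finite_same_card_bij[of "UNIV::'n set" B] by auto
  have eB: "e i \<in> B" for i using e by (auto simp: bij_betw_def)
  obtain l where l: "\<And>i. A *v e i = l i *\<^sub>R e i" using B(4)[OF eB] by metis
  have "e i \<bullet> e j = (if i = j then 1 else 0)" for i j
  proof (cases "i = j")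
    case False
    then have "e i \<noteq> e j" using e by (auto simp: bij_betw_def inj_on_def)
    then show ?thesis using B(3) eB False by (auto simp: pairwise_def orthogonal_def)
  qed (use B(4)[OF eB] in \<open>simp add: norm_eq_1\<close>)
  then have "eigensystem A (\<chi> i. e i) (\<chi> i. l i)" using l by (simp add: eigensystem_def)
  then show ?thesis using that by blast
qed

definition spectral_matrix :: "real^'n^'n \<Rightarrow> real^'n \<Rightarrow> real^'n^'n" where
  "spectral_matrix U l = transpose U ** (\<chi> i j. if i = j then l $ i else 0) ** U"

lemma orthonormal_rows_iff:
  fixes U :: "real^'n^'n"
  shows "orthogonal_matrix U \<longleftrightarrow> (\<forall>i j. U $ i \<bullet> U $ j = (if i = j then 1 else 0))"
proof -
  have "orthogonal_matrix U \<longleftrightarrow> U ** transpose U = mat 1"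
    by (metis orthogonal_matrix orthogonal_matrix_transpose transpose_transpose)
  moreover have "(U ** transpose U) $ i $ j = U $ i \<bullet> U $ j" for i j
    by (simp add: matrix_matrix_mult_def transpose_def inner_vec_def)
  ultimately show ?thesis by (auto simp: vec_eq_iff mat_def)
qed

lemma eigensystem_orthogonal: "eigensystem A U l \<Longrightarrow> orthogonal_matrix U"
  by (simp add: eigensystem_def orthonormal_rows_iff)

text \<open>Reduces identities between matrices to their action on an orthonormal basis, in
  particular on an eigenbasis.\<close>

lemma orthogonal_matrix_eqI:
  fixes U :: "real^'n^'n" and A B :: "real^'n^'m"
  assumes U: "orthogonal_matrix U" and eq: "\<And>i. A *v (U $ i) = B *v (U $ i)"
  shows "A = B"
proof -
  have col: "(C ** transpose U) $ a $ i = (C *v (U $ i)) $ a" for C :: "real^'n^'m" and a i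
    by (simp add: matrix_matrix_mult_def matrix_vector_mult_def transpose_def)
  have "A ** transpose U = B ** transpose U" by (simp add: vec_eq_iff col eq)
  then have "A ** (transpose U ** U) = B ** (transpose U ** U)" by (simp add: matrix_mul_assoc)
  then show ?thesis using U by (simp add: orthogonal_matrix_def)
qed

lemma spectral_matrix_eigen:
  fixes U :: "real^'n^'n"
  assumes U: "orthogonal_matrix U"
  shows "spectral_matrix U l *v (U $ i) = l $ i *\<^sub>R U $ i"
proof -
  have "U *v (U $ i) = axis i 1"
    using U by (simp add: vec_eq_iff orthonormal_rows_iff matrix_vector_mult_def axis_def inner_vec_def)
  moreover have "(\<chi> i j. if i = j then l $ i else 0) *v axis i 1 = l $ i *\<^sub>R axis i (1::real)"
    by (auto simp: vec_eq_iff matrix_vector_mult_def axis_def mult_delta_left)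
  moreover have "transpose U *v axis i 1 = U $ i"
    by (simp add: vec_eq_iff vector_matrix_mult_def axis_def mult_delta_left)
  ultimately show ?thesis
    by (simp only: spectral_matrix_def matrix_vector_mul_assoc[symmetric] matrix_vector_mult_scaleR)
qed

lemma eigensystem_iff: "eigensystem A U l \<longleftrightarrow> orthogonal_matrix U \<and> A = spectral_matrix U l"
proof
  assume e: "eigensystem A U l"
  then have "orthogonal_matrix U" by (rule eigensystem_orthogonal)
  then show "orthogonal_matrix U \<and> A = spectral_matrix U l"
    using orthogonal_matrix_eqI[of U A] e spectral_matrix_eigen[of U l] by (simp add: eigensystem_def)
next
  assume "orthogonal_matrix U \<and> A = spectral_matrix U l"
  then show "eigensystem A U l"
    using spectral_matrix_eigen[of U l] by (simp add: eigensystem_def orthonormal_rows_iff[symmetric])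
qed

lemma spectral_matrix_mult:
  assumes U: "orthogonal_matrix U"
  shows "spectral_matrix U l ** spectral_matrix U m = spectral_matrix U (\<chi> i. l $ i * m $ i)"
  by (rule orthogonal_matrix_eqI[OF U])
    (simp add: matrix_vector_mul_assoc[symmetric] spectral_matrix_eigen[OF U] matrix_vector_mult_scaleR mult.commute)

lemma spectral_matrix_symmetric: "transpose (spectral_matrix U l) = spectral_matrix U l"
proof -
  have "transpose (\<chi> i j. if i = j then l $ i else 0) = (\<chi> i j. if i = j then l $ i else 0)"
    by (auto simp: transpose_def vec_eq_iff)
  then show ?thesis by (simp add: spectral_matrix_def matrix_transpose_mul matrix_mul_assoc)
qed

lemma tendsto_spectral_matrix:
  fixes U :: "'k \<Rightarrow> real^'n^'n"
  assumes "(U \<longlongrightarrow> U0) F" "(l \<longlongrightarrow> l0) F"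
  shows "((\<lambda>k. spectral_matrix (U k) (l k)) \<longlongrightarrow> spectral_matrix U0 l0) F"
proof -
  have "((\<lambda>k. (\<chi> i j. if i = j then l k $ i else 0) :: real^'n^'n) \<longlongrightarrow> (\<chi> i j. if i = j then l0 $ i else 0)) F"
    using assms by (intro vec_tendstoI) (simp add: tendsto_vec_nth)
  then show ?thesis unfolding spectral_matrix_def
    by (intro tendsto_matrix_mult tendsto_transpose assms)
qed

section \<open>Pseudoinverse and rank in an eigenbasis\<close>

lemma penrose_unique:
  fixes A :: "real^'n^'m"
  assumes X: "A ** X ** A = A" "X ** A ** X = X" "transpose (A ** X) = A ** X" "transpose (X ** A) = X ** A"
    and Y: "A ** Y ** A = A" "Y ** A ** Y = Y" "transpose (A ** Y) = A ** Y" "transpose (Y ** A) = Y ** A"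
  shows "X = Y"
proof -
  have AX: "A ** X = A ** Y"
  proof -
    have "A ** X = transpose (A ** X)" by (simp add: X)
    also have "\<dots> = transpose (A ** Y ** (A ** X))" by (simp add: matrix_mul_assoc Y)
    also have "\<dots> = (A ** X) ** (A ** Y)" by (simp only: matrix_transpose_mul[of "A ** Y"] X Y)
    also have "\<dots> = A ** Y" by (simp add: matrix_mul_assoc X)
    finally show ?thesis .
  qed
  have XA: "X ** A = Y ** A"
  proof -
    have "X ** A = transpose (X ** A)" by (simp add: X)
    also have "\<dots> = transpose ((X ** A) ** (Y ** A))" by (metis matrix_mul_assoc Y(1))
    also have "\<dots> = (Y ** A) ** (X ** A)" by (simp only: matrix_transpose_mul[of "X ** A"] X Y)
    also have "\<dots> = Y ** A" by (metis matrix_mul_assoc X(1))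
    finally show ?thesis .
  qed
  have "X = X ** A ** Y" using X(2) AX by (metis matrix_mul_assoc)
  then show ?thesis using XA Y(2) by metis
qed

lemma pinv_eqI:
  fixes A :: "real^'n^'m"
  assumes "A ** X ** A = A" "X ** A ** X = X" "transpose (A ** X) = A ** X" "transpose (X ** A) = X ** A"
  shows "pinv A = X"
  unfolding pinv_def using assms by (intro the_equality) (auto intro: penrose_unique)

text \<open>The convention \<open>inverse 0 = 0\<close> makes entrywise inversion of the eigenvalues
  exactly the pseudoinverse, kernel included.\<close>

lemma pinv_spectral_matrix:
  fixes U :: "real^'n^'n"
  assumes "orthogonal_matrix U"
  shows "pinv (spectral_matrix U l) = spectral_matrix U (\<chi> i. inverse (l $ i))"
proof -
  have [simp]: "x * (x * inverse x) = x" "inverse x * (x * inverse x) = inverse x" for x :: real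
    by (cases "x = 0"; simp)+
  show ?thesis
    by (rule pinv_eqI) (simp_all add: spectral_matrix_mult[OF assms] spectral_matrix_symmetric mult.commute)
qed

text \<open>A symmetric matrix and its pseudoinverse are diagonal in the same basis. Hence they
  commute, and their product is the orthogonal projection onto the range.\<close>

lemma pinv_symmetric:
  fixes A :: "real^'n^'n"
  assumes "transpose A = A"
  shows "transpose (pinv A) = pinv A" "A ** pinv A ** A = A" "pinv A ** A ** pinv A = pinv A"
    "transpose (A ** pinv A) = A ** pinv A" "pinv A ** A = A ** pinv A"
proof -
  obtain U l where "eigensystem A U l" using eigensystem_exists[OF assms] .
  then have U: "orthogonal_matrix U" and A: "A = spectral_matrix U l" by (auto simp: eigensystem_iff)
  have [simp]: "x * (x * inverse x) = x" "inverse x * (x * inverse x) = inverse x" for x :: real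
    by (cases "x = 0"; simp)+
  show "transpose (pinv A) = pinv A" "A ** pinv A ** A = A" "pinv A ** A ** pinv A = pinv A"
    "transpose (A ** pinv A) = A ** pinv A" "pinv A ** A = A ** pinv A"
    by (simp_all add: A pinv_spectral_matrix[OF U] spectral_matrix_mult[OF U] spectral_matrix_symmetric mult.commute)
qed

text \<open>The eigenvectors with nonzero eigenvalue form an orthonormal basis of the range.\<close>

lemma rank_spectral_matrix:
  fixes U :: "real^'n^'n"
  assumes U: "orthogonal_matrix U"
  shows "rank (spectral_matrix U l) = card {i. l $ i \<noteq> 0}"
proof -
  let ?A = "spectral_matrix U l" and ?B = "(\<lambda>i. U $ i) ` {i. l $ i \<noteq> 0}"
  have o: "U $ i \<bullet> U $ j = (if i = j then 1 else 0)" for i j using U by (simp add: orthonormal_rows_iff)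
  have inj: "inj (\<lambda>i. U $ i)" by (rule injI) (metis o zero_neq_one)
  have "pairwise orthogonal ?B" by (auto simp: pairwise_def orthogonal_def o)
  moreover have "0 \<notin> ?B" by (metis (no_types, lifting) imageE inner_zero_left o zero_neq_one)
  ultimately have "independent ?B" by (rule pairwise_orthogonal_independent)
  have "range (\<lambda>x. ?A *v x) = span ?B"
  proof (intro subset_antisym subsetI)
    fix y assume "y \<in> range (\<lambda>x. ?A *v x)"
    then obtain x where x: "y = ?A *v x" by blast
    have "x = (transpose U ** U) *v x" using U by (simp add: orthogonal_matrix_def)
    also have "\<dots> = transpose U *v (U *v x)" by (simp add: matrix_vector_mul_assoc)
    also have "\<dots> = (\<Sum>i\<in>UNIV. (U *v x) $ i *\<^sub>R U $ i)"
      by (simp add: vec_eq_iff vector_matrix_mult_def mult.commute)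
    finally have "y = ?A *v (\<Sum>i\<in>UNIV. (U *v x) $ i *\<^sub>R U $ i)" using x by simp
    also have "\<dots> = (\<Sum>i\<in>UNIV. ?A *v ((U *v x) $ i *\<^sub>R U $ i))"
      by (rule linear_sum) simp
    also have "\<dots> = (\<Sum>i\<in>UNIV. ((U *v x) $ i * l $ i) *\<^sub>R U $ i)"
      by (simp add: matrix_vector_mult_scaleR spectral_matrix_eigen[OF U])
    also have "\<dots> \<in> span ?B"
    proof (rule span_sum)
      fix i
      show "((U *v x) $ i * l $ i) *\<^sub>R U $ i \<in> span ?B"
        by (cases "l $ i = 0") (auto intro: span_scale span_base simp: span_zero)
    qed
    finally show "y \<in> span ?B" .
  next
    fix y assume y: "y \<in> span ?B"
    have "?B \<subseteq> range (\<lambda>x. ?A *v x)"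
    proof safe
      fix i assume "l $ i \<noteq> 0"
      then have "U $ i = ?A *v (inverse (l $ i) *\<^sub>R U $ i)"
        by (simp add: matrix_vector_mult_scaleR spectral_matrix_eigen[OF U])
      then show "U $ i \<in> range (\<lambda>x. ?A *v x)" by blast
    qed
    then have "span ?B \<subseteq> range (\<lambda>x. ?A *v x)"
      by (rule span_minimal) (simp add: linear_subspace_image)
    then show "y \<in> range (\<lambda>x. ?A *v x)" using y by blast
  qed
  then have "rank ?A = dim (span ?B)" by (simp add: rank_dim_range)
  also have "\<dots> = card ?B" using \<open>independent ?B\<close> by (simp add: dim_eq_card_independent)
  also have "\<dots> = card {i. l $ i \<noteq> 0}" using inj by (intro card_image) (auto simp: inj_on_def)
  finally show ?thesis .
qed

subsection \<open>Ordered eigenvalues\<close>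

lemma index_list: "distinct (index_list :: 'n::finite list)" "set (index_list :: 'n list) = UNIV"
proof -
  have "\<exists>is :: 'n list. distinct is \<and> set is = UNIV" using finite_distinct_list[of "UNIV :: 'n set"] by auto
  from someI_ex[OF this] show "distinct (index_list :: 'n list)" "set (index_list :: 'n list) = UNIV"
    by (auto simp: index_list_def)
qed

lemma length_index_list: "length (index_list :: 'n::finite list) = CARD('n)"
  using index_list distinct_card by metis

text \<open>Similarity carried out over the polynomial ring: \<open>C\<close> embeds real matrices
  as constants, \<open>X\<close> is the indeterminate times the identity and commutes with
  everything, so conjugation by \<open>C U\<close> leaves the determinant of a diagonal
  matrix.\<close>

lemma char_polynomial_spectral_matrix:
  fixes U :: "real^'n^'n"
  assumes U: "orthogonal_matrix U"
  shows "char_polynomial (spectral_matrix U l) = (\<Prod>i\<in>UNIV. [:- l $ i, 1:])"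
proof -
  define C where "C A = (\<chi> i j. [:A $ i $ j:])" for A :: "real^'n^'n"
  define X where "X = (\<chi> i j. if i = j then [:0, 1:] else 0 :: real poly^'n^'n)"
  have const_sum: "[:sum g S:] = (\<Sum>k\<in>S. [:g k:])" for g :: "'n \<Rightarrow> real" and S
  proof (induction S rule: infinite_finite_induct)
    case (insert x F)
    have "[:g x + sum g F:] = [:g x:] + [:sum g F:]" by simp
    then show ?case using insert(3) by (simp only: sum.insert[OF insert(1,2)])
  qed simp_all
  have C_mult: "C (A ** B) = C A ** C B" for A B
    by (simp add: C_def vec_eq_iff matrix_matrix_mult_def const_sum mult.commute)
  have C1: "C (mat 1) = mat 1" by (simp add: C_def vec_eq_iff mat_def)
  have comm: "X ** B = B ** X" for B
    by (simp add: X_def vec_eq_iff matrix_matrix_mult_def mult_delta_left mult_delta_right mult.commute)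
  let ?D = "(\<chi> i j. if i = j then l $ i else 0) :: real^'n^'n"
  have CC: "C (transpose U) ** C U = mat 1" using U by (simp add: C_mult[symmetric] C1 orthogonal_matrix_def)
  have distl: "A ** (B - B') = A ** B - A ** B'" for A B B' :: "real poly^'n^'n"
    by (simp add: vec_eq_iff matrix_matrix_mult_def right_diff_distrib sum_subtractf)
  have distr: "(B - B') ** A = B ** A - B' ** A" for A B B' :: "real poly^'n^'n"
    by (simp add: vec_eq_iff matrix_matrix_mult_def left_diff_distrib sum_subtractf)
  have "X - C (spectral_matrix U l) = C (transpose U) ** (X - C ?D) ** C U"
    by (simp add: spectral_matrix_def C_mult distl distr comm[symmetric])
      (simp add: matrix_mul_assoc[symmetric] CC)
  then have "det (X - C (spectral_matrix U l)) = (det (C (transpose U)) * det (C U)) * det (X - C ?D)"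
    by (simp add: det_mul mult.commute mult.left_commute)
  also have "det (C (transpose U)) * det (C U) = 1" by (simp add: det_mul[symmetric] CC)
  also have "det (X - C ?D) = (\<Prod>i\<in>UNIV. [:- l $ i, 1:])"
    by (subst det_diagonal) (auto simp: X_def C_def)
  finally show ?thesis by (simp add: char_polynomial_def X_def C_def minus_vec_def)
qed

lemma eigvals_desc_eigensystem:
  fixes A :: "real^'n^'n"
  assumes "eigensystem A U l"
  shows "eigvals_desc A = rev (sort (map (\<lambda>i. l $ i) index_list))"
proof -
  have "proots (char_polynomial A) = (\<Sum>i\<in>UNIV. {#l $ i#})"
    using assms by (simp add: eigensystem_iff char_polynomial_spectral_matrix proots_prod)
  also have "\<dots> = image_mset (\<lambda>i. l $ i) (mset_set UNIV)"
    by (simp add: sum_unfold_sum_mset)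
  also have "mset_set (UNIV :: 'n set) = mset index_list" using index_list by (metis mset_set_set)
  finally show ?thesis by (simp add: eigvals_desc_def flip: mset_map)
qed

text \<open>An eigensystem may be reindexed freely, so its eigenvalues can be made to decrease along
  the fixed enumeration \<open>index_list\<close>. This identifies the i-th ordered eigenvalue with
  a coordinate of \<open>l\<close>.\<close>

lemma ordered_eigensystem_exists:
  fixes A :: "real^'n^'n"
  assumes "transpose A = A"
  obtains U l where "eigensystem A U l" "eigvals_desc A = map (\<lambda>i. l $ i) index_list"
proof -
  obtain U l where e: "eigensystem A U l" using eigensystem_exists[OF assms] .
  \<comment> \<open>\<open>js\<close> lists the indices by decreasing eigenvalue, and \<pi> sends
    the k-th entry of \<open>index_list\<close> to the k-th entry of \<open>js\<close>.\<close>
  define js where "js = rev (sort_key (\<lambda>i. l $ i) (index_list :: 'n list))"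
  define pos where "pos = the_inv_into {..<CARD('n)} ((!) (index_list :: 'n list))"
  have bij: "bij_betw ((!) (index_list :: 'n list)) {..<CARD('n)} UNIV"
    by (rule bij_betw_nth) (simp_all add: index_list length_index_list)
  define \<pi> where "\<pi> i = js ! pos i" for i
  have len: "length js = CARD('n)" by (simp add: js_def length_index_list)
  have map_\<pi>: "map \<pi> index_list = js"
  proof (rule nth_equalityI)
    fix k assume "k < length (map \<pi> index_list)"
    then have k: "k < CARD('n)" by (simp add: length_index_list)
    have "pos (index_list ! k) = k"
      unfolding pos_def using bij k by (intro the_inv_into_f_f) (auto simp: bij_betw_def)
    then show "map \<pi> index_list ! k = js ! k" using k by (simp add: length_index_list \<pi>_def)
  qed (simp add: len length_index_list)
  have "range \<pi> = UNIV"
  proof -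
    have "\<pi> ` set index_list = set js" using map_\<pi> by (metis list.set_map)
    then show ?thesis using index_list(2) by (metis js_def set_rev set_sort)
  qed
  then have "inj \<pi>" by (simp add: finite_UNIV_surj_inj)
  then have "eigensystem A (\<chi> i. U $ \<pi> i) (\<chi> i. l $ \<pi> i)"
    using e by (auto simp: eigensystem_def inj_def)
  moreover have "map (\<lambda>i. (\<chi> i. l $ \<pi> i) $ i) index_list = map (\<lambda>i. l $ i) js"
    by (simp flip: map_\<pi>)
  moreover have "map (\<lambda>i. l $ i) js = rev (sort (map (\<lambda>i. l $ i) index_list))"
  proof -
    have "map (\<lambda>i. l $ i) (sort_key (\<lambda>i. l $ i) (index_list :: 'n list)) = sort (map (\<lambda>i. l $ i) index_list)"
      by (rule properties_for_sort[symmetric]) simp_all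
    then show ?thesis by (simp add: js_def rev_map[symmetric])
  qed
  ultimately show ?thesis using that eigvals_desc_eigensystem[OF e] by metis
qed

lemma eigvals_desc_eigensystem_sorted:
  fixes A :: "real^'n^'n"
  assumes "eigensystem A U l" "sorted_wrt (\<ge>) (map (\<lambda>i. l $ i) index_list)"
  shows "eigvals_desc A = map (\<lambda>i. l $ i) index_list"
proof -
  have "sorted (rev (map (\<lambda>i. l $ i) index_list))" using assms(2) by (simp add: sorted_wrt_rev)
  then have "sort (map (\<lambda>i. l $ i) index_list) = rev (map (\<lambda>i. l $ i) index_list)"
    by (intro properties_for_sort) simp_all
  then show ?thesis using eigvals_desc_eigensystem[OF assms(1)] by simp
qed

lemma eigvals_desc_sorted: "sorted_wrt (\<ge>) (eigvals_desc A)"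
  by (simp add: eigvals_desc_def sorted_wrt_rev)

text \<open>Compactness: the rows of \<open>U k\<close> are unit vectors, and the eigenvalues are
  bounded by the operator norms of a convergent sequence. Orthonormality, the eigenvector equations
  and the ordering are closed conditions, so the limit is an ordered eigensystem of
  \<open>A0\<close>. The given \<open>r\<close> prepares the use of
  \<open>tendsto_of_subsequences\<close>.\<close>

lemma eigensystem_subsequence:
  fixes A :: "nat \<Rightarrow> real^'n^'n" and r :: "nat \<Rightarrow> nat"
  assumes A: "A \<longlonglongrightarrow> A0"
    and e: "\<And>k. eigensystem (A k) (U k) (l k)" "\<And>k. eigvals_desc (A k) = map (\<lambda>i. l k $ i) index_list"
    and r: "strict_mono r"
  obtains s U0 l0 where "strict_mono s" "(\<lambda>k. U (r (s k))) \<longlonglongrightarrow> U0" "(\<lambda>k. l (r (s k))) \<longlonglongrightarrow> l0"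
    "eigensystem A0 U0 l0" "eigvals_desc A0 = map (\<lambda>i. l0 $ i) index_list"
proof -
  have nU: "norm (U k $ i) = 1" for k i using e(1)[of k] by (simp add: eigensystem_def norm_eq_1)
  have bU: "norm (U k) \<le> CARD('n)" for k
  proof -
    have "norm (U k) \<le> (\<Sum>i\<in>UNIV. norm (U k $ i))"
      unfolding norm_vec_def[of "U k"] by (rule L2_set_le_sum) simp
    then show ?thesis by (simp add: nU)
  qed
  have "(\<lambda>k. \<Sum>i\<in>UNIV. \<Sum>j\<in>UNIV. \<bar>A k $ i $ j\<bar>) \<longlonglongrightarrow> (\<Sum>i\<in>UNIV. \<Sum>j\<in>UNIV. \<bar>A0 $ i $ j\<bar>)"
    by (intro tendsto_intros A)
  then have "Bseq (\<lambda>k. \<Sum>i\<in>UNIV. \<Sum>j\<in>UNIV. \<bar>A k $ i $ j\<bar>)"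
    by (rule convergent_imp_Bseq[OF convergentI])
  then obtain M where M: "\<And>k. \<bar>\<Sum>i\<in>UNIV. \<Sum>j\<in>UNIV. \<bar>A k $ i $ j\<bar>\<bar> \<le> M" by (auto simp: Bseq_def)
  have bl: "\<bar>l k $ i\<bar> \<le> M" for k i
  proof -
    have "\<bar>l k $ i\<bar> = norm (A k *v (U k $ i))" using e(1)[of k] by (simp add: eigensystem_def nU)
    also have "\<dots> \<le> onorm ((*v) (A k))"
      using onorm[OF matrix_vector_mul_bounded_linear, of "A k" "U k $ i"] by (simp add: nU)
    also have "\<dots> \<le> M" using onorm_le_matrix_component_sum[of "A k"] M[of k] by linarith
    finally show ?thesis .
  qed
  have "norm (l k) \<le> CARD('n) * M" for k
  proof -
    have "norm (l k) \<le> (\<Sum>i\<in>UNIV. \<bar>l k $ i\<bar>)" by (rule norm_le_l1_cart)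
    also have "\<dots> \<le> (\<Sum>i\<in>(UNIV::'n set). M)" by (intro sum_mono bl)
    finally show ?thesis by simp
  qed
  then have "bounded (range (\<lambda>k. (U (r k), l (r k))))"
    using bU by (intro bounded_subset[OF bounded_Times[OF bounded_cball[of 0 "CARD('n)"] bounded_cball[of 0 "CARD('n) * M"]]]) auto
  then obtain p s where s: "strict_mono s" and p: "((\<lambda>k. (U (r k), l (r k))) \<circ> s) \<longlonglongrightarrow> p"
    using bounded_imp_convergent_subsequence[of "\<lambda>k. (U (r k), l (r k))"] by blast
  obtain U0 l0 where p0: "p = (U0, l0)" by fastforce
  have U0: "(\<lambda>k. U (r (s k))) \<longlonglongrightarrow> U0" and l0: "(\<lambda>k. l (r (s k))) \<longlonglongrightarrow> l0"
    using tendsto_fst[OF p] tendsto_snd[OF p] by (simp_all add: o_def p0)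
  have "strict_mono (r \<circ> s)" using r s by (rule strict_mono_o)
  then have A': "(\<lambda>k. A (r (s k))) \<longlonglongrightarrow> A0" using LIMSEQ_subseq_LIMSEQ[OF A] by (simp add: o_def)
  have "eigensystem A0 U0 l0"
    unfolding eigensystem_def
  proof (intro conjI allI)
    fix i j
    have "(\<lambda>k. U (r (s k)) $ i \<bullet> U (r (s k)) $ j) \<longlonglongrightarrow> U0 $ i \<bullet> U0 $ j" by (intro tendsto_intros U0)
    moreover have "(\<lambda>k. U (r (s k)) $ i \<bullet> U (r (s k)) $ j) = (\<lambda>k. if i = j then 1 else 0)"
      using e(1) by (simp add: eigensystem_def)
    ultimately show "U0 $ i \<bullet> U0 $ j = (if i = j then 1 else 0)" by (simp add: LIMSEQ_const_iff)
  next
    fix i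
    have "(\<lambda>k. A (r (s k)) *v (U (r (s k)) $ i)) \<longlonglongrightarrow> A0 *v (U0 $ i)"
      by (intro tendsto_matrix_vector_mult A' tendsto_vec_nth U0)
    moreover have "(\<lambda>k. l (r (s k)) $ i *\<^sub>R U (r (s k)) $ i) \<longlonglongrightarrow> l0 $ i *\<^sub>R U0 $ i"
      by (intro tendsto_intros U0 l0)
    moreover have "A (r (s k)) *v (U (r (s k)) $ i) = l (r (s k)) $ i *\<^sub>R U (r (s k)) $ i" for k
      using e(1) by (simp add: eigensystem_def)
    ultimately show "A0 *v (U0 $ i) = l0 $ i *\<^sub>R U0 $ i" by (metis (no_types, lifting) LIMSEQ_unique ext)
  qed
  moreover have "sorted_wrt (\<ge>) (map (\<lambda>i. l0 $ i) index_list)"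
  proof (subst sorted_wrt_iff_nth_less, safe)
    fix a b assume ab: "a < b" "b < length (map (\<lambda>i. l0 $ i) (index_list :: 'n list))"
    have "l (r (s k)) $ (index_list ! b) \<le> l (r (s k)) $ (index_list ! a)" for k
      using eigvals_desc_sorted[of "A (r (s k))"] ab unfolding e(2) sorted_wrt_iff_nth_less by auto
    then have "l0 $ (index_list ! b) \<le> l0 $ (index_list ! a)"
      by (intro LIMSEQ_le[OF tendsto_vec_nth[OF l0] tendsto_vec_nth[OF l0]]) auto
    then show "map (\<lambda>i. l0 $ i) (index_list :: 'n list) ! b \<le> map (\<lambda>i. l0 $ i) index_list ! a" using ab by simp
  qed
  ultimately show ?thesis using that s U0 l0 eigvals_desc_eigensystem_sorted by blast
qed

text \<open>Every subsequential limit of the ordered lists is the ordered list of \<open>A0\<close>,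
  which does not depend on the eigenbasis reached.\<close>

lemma eigvals_desc_tendsto:
  fixes A :: "nat \<Rightarrow> real^'n^'n"
  assumes A: "A \<longlonglongrightarrow> A0" and sym: "\<And>k. transpose (A k) = A k" and i: "i < CARD('n)"
  shows "(\<lambda>k. eigvals_desc (A k) ! i) \<longlonglongrightarrow> eigvals_desc A0 ! i"
proof -
  have "\<forall>k. \<exists>U l. eigensystem (A k) U l \<and> eigvals_desc (A k) = map (\<lambda>i. l $ i) index_list"
    using ordered_eigensystem_exists[OF sym] by blast
  then obtain U l where e: "\<And>k. eigensystem (A k) (U k) (l k)"
    "\<And>k. eigvals_desc (A k) = map (\<lambda>i. l k $ i) index_list" by metis
  show ?thesis
  proof (rule tendsto_of_subsequences)
    fix r :: "nat \<Rightarrow> nat" assume "strict_mono r"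
    then obtain s U0 l0 where s: "strict_mono s" "(\<lambda>k. l (r (s k))) \<longlonglongrightarrow> l0"
      "eigvals_desc A0 = map (\<lambda>i. l0 $ i) index_list"
      by (rule eigensystem_subsequence[OF A e]) blast
    then have "(\<lambda>k. eigvals_desc (A (r (s k))) ! i) \<longlonglongrightarrow> eigvals_desc A0 ! i"
      using i by (simp add: e(2) length_index_list tendsto_vec_nth)
    then show "\<exists>s. strict_mono s \<and> (\<lambda>k. eigvals_desc (A (r (s k))) ! i) \<longlonglongrightarrow> eigvals_desc A0 ! i"
      using s(1) by blast
  qed
qed

text \<open>Inversion of the eigenvalues is discontinuous only at 0. Eigenvalues with nonzero limit
  are eventually nonzero, and since the rank counts the nonzero ones, all others must eventually be
  exactly 0, where \<open>inverse\<close> gives 0 as well.\<close>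

lemma pinv_tendsto_of_constant_rank:
  fixes A :: "nat \<Rightarrow> real^'n^'n"
  assumes A: "A \<longlonglongrightarrow> A0" and sym: "\<And>k. transpose (A k) = A k"
    and rank: "eventually (\<lambda>k. rank (A k) = rank A0) sequentially"
  shows "(\<lambda>k. pinv (A k)) \<longlonglongrightarrow> pinv A0"
proof -
  have "\<forall>k. \<exists>U l. eigensystem (A k) U l \<and> eigvals_desc (A k) = map (\<lambda>i. l $ i) index_list"
    using ordered_eigensystem_exists[OF sym] by blast
  then obtain U l where e: "\<And>k. eigensystem (A k) (U k) (l k)"
    "\<And>k. eigvals_desc (A k) = map (\<lambda>i. l k $ i) index_list" by metis
  show ?thesis
  proof (rule tendsto_of_subsequences)
    fix r :: "nat \<Rightarrow> nat" assume r: "strict_mono r"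
    obtain s U0 l0 where s: "strict_mono s" "(\<lambda>k. U (r (s k))) \<longlonglongrightarrow> U0" "(\<lambda>k. l (r (s k))) \<longlonglongrightarrow> l0"
      "eigensystem A0 U0 l0"
      by (rule eigensystem_subsequence[OF A e r])
    have "eventually (\<lambda>k. rank (A ((r \<circ> s) k)) = rank A0) sequentially"
      using rank eventually_subseq[OF strict_mono_o[OF r s(1)]] by blast
    then have rk: "eventually (\<lambda>k. card {i. l (r (s k)) $ i \<noteq> 0} = card {i. l0 $ i \<noteq> 0}) sequentially"
      using e(1) s(4) by (simp add: eigensystem_iff rank_spectral_matrix)
    have "eventually (\<lambda>k. l0 $ i \<noteq> 0 \<longrightarrow> l (r (s k)) $ i \<noteq> 0) sequentially" for i
      using tendsto_imp_eventually_ne[OF tendsto_vec_nth[OF s(3)], of i 0] by (cases "l0 $ i = 0") auto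
    then have "eventually (\<lambda>k. \<forall>i. l0 $ i \<noteq> 0 \<longrightarrow> l (r (s k)) $ i \<noteq> 0) sequentially"
      by (simp add: eventually_all_finite)
    then have supp: "eventually (\<lambda>k. {i. l (r (s k)) $ i \<noteq> 0} = {i. l0 $ i \<noteq> 0}) sequentially"
      using rk
    proof eventually_elim
      case (elim k)
      then have "{i. l0 $ i \<noteq> 0} \<subseteq> {i. l (r (s k)) $ i \<noteq> 0}" by blast
      then show ?case using elim(2) by (metis card_subset_eq finite)
    qed
    have "(\<lambda>k. inverse (l (r (s k)) $ i)) \<longlonglongrightarrow> inverse (l0 $ i)" for i
    proof (cases "l0 $ i = 0")
      case True
      have "eventually (\<lambda>k. inverse (l (r (s k)) $ i) = 0) sequentially"
        using supp by eventually_elim (use True in auto)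
      then show ?thesis using True by (simp add: tendsto_eventually)
    qed (intro tendsto_inverse tendsto_vec_nth s(3))
    then have "(\<lambda>k. \<chi> i. inverse (l (r (s k)) $ i)) \<longlonglongrightarrow> (\<chi> i. inverse (l0 $ i))"
      by (intro vec_tendstoI) simp
    then have "(\<lambda>k. spectral_matrix (U (r (s k))) (\<chi> i. inverse (l (r (s k)) $ i))) \<longlonglongrightarrow> spectral_matrix U0 (\<chi> i. inverse (l0 $ i))"
      by (rule tendsto_spectral_matrix[OF s(2)])
    then have "(\<lambda>k. pinv (A (r (s k)))) \<longlonglongrightarrow> pinv A0"
      using e(1) s(4) by (simp add: eigensystem_iff pinv_spectral_matrix)
    then show "\<exists>s. strict_mono s \<and> (\<lambda>k. pinv (A (r (s k)))) \<longlonglongrightarrow> pinv A0" using s(1) by blast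
  qed
qed

subsection \<open>The regularized linear system\<close>

text \<open>The properties of the Jacobian blocks that the linear algebra below uses; neither
  \<open>f\<close>, \<open>g\<close> nor \<theta> appears in it any more.\<close>

definition monotone_blocks :: "('n::finite, 'm::finite) blocks \<Rightarrow> bool" where
  "monotone_blocks D \<longleftrightarrow> (case D of (Q, P, H, M) \<Rightarrow>
     transpose Q = Q \<and> (\<forall>u. (norm (Q *v u))\<^sup>2 \<le> (Q *v u) \<bullet> u) \<and>
     transpose H = H \<and> (\<forall>u. 0 \<le> (H *v u) \<bullet> u))"

lemma D_set_monotone_blocks:
  assumes "composite_regularity \<O> f g L \<epsilon>\<^sub>b \<gamma>" "open \<O>" "\<theta> \<in> \<O>" "D \<in> D_set f g \<gamma> \<epsilon> x \<theta>"
  shows "monotone_blocks D"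
  using D_set_symmetric_psd[OF assms(1-3)] assms(4) unfolding monotone_blocks_def by (cases D) auto

lemma matrix_scaleR_vector: "(c *\<^sub>R A) *v x = c *\<^sub>R (A *v x)" for A :: "real^'n^'m"
  by (rule scaleR_matrix_vector_assoc[symmetric])

section \<open>The projection onto range(Q) and the matrix Sigma\<close>

context
  fixes Q H q Pr S :: "real^'n^'n" and P M N V :: "real^'m^'n" and D :: "('n, 'm) blocks" and \<gamma> :: real
  assumes D: "D = (Q, P, H, M)" and mono: "monotone_blocks D" and \<gamma>: "\<gamma> > 0"
  defines "q \<equiv> pinv Q" and "Pr \<equiv> Pi_mat D" and "S \<equiv> Sigma_mat \<gamma> D" and "N \<equiv> M_mat \<gamma> D" and "V \<equiv> V_mat \<gamma> D"
begin

lemma Q_sym: "transpose Q = Q" and Q_firmly_nonexpansive: "(norm (Q *v u))\<^sup>2 \<le> (Q *v u) \<bullet> u"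
  and H_sym: "transpose H = H" and H_psd: "0 \<le> (H *v u) \<bullet> u"
  using mono D by (auto simp: monotone_blocks_def)

lemma Pi_vec: "Pr *v x = Q *v (q *v x)"
  by (simp add: Pr_def q_def D matrix_vector_mul_assoc)

lemma pinv_Q_Q: "q *v (Q *v x) = Pr *v x"
  using pinv_symmetric(5)[OF Q_sym] by (simp add: Pr_def q_def D matrix_vector_mul_assoc)

lemma Q_Pi: "Q *v (Pr *v x) = Q *v x"
  using pinv_symmetric(2)[OF Q_sym] by (simp add: pinv_Q_Q[symmetric] q_def matrix_vector_mul_assoc matrix_mul_assoc)

lemma Pi_Q: "Pr *v (Q *v x) = Q *v x"
  by (subst Pi_vec) (simp add: pinv_Q_Q Q_Pi)

lemma pinv_Q_Pi: "q *v (Pr *v x) = q *v x"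
  using pinv_symmetric(3)[OF Q_sym] by (simp add: Pi_vec q_def matrix_vector_mul_assoc matrix_mul_assoc)

lemma Pi_pinv_Q: "Pr *v (q *v x) = q *v x"
  by (metis pinv_Q_Pi pinv_Q_Q Pi_vec)

lemma Pi_idem: "Pr *v (Pr *v x) = Pr *v x"
  by (simp add: Pi_vec[of x] Pi_Q)

lemma Pi_dot: "(Pr *v x) \<bullet> y = x \<bullet> (Pr *v y)"
  using pinv_symmetric(4)[OF Q_sym] by (intro symmetric_dot) (simp add: Pr_def D)

lemma pinv_Q_dot: "(q *v x) \<bullet> y = x \<bullet> (q *v y)"
  using pinv_symmetric(1)[OF Q_sym] by (intro symmetric_dot) (simp add: q_def)

lemma Sigma_vec: "S *v x = q *v x - Pr *v x + \<gamma> *\<^sub>R (Pr *v (H *v (Pr *v x)))"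
  by (simp add: S_def q_def Pr_def D Let_def matrix_vector_mult_add_rdistrib matrix_vector_mult_diff_rdistrib
      matrix_scaleR_vector matrix_vector_mul_assoc matrix_mul_assoc)

lemma Pi_Sigma: "Pr *v (S *v x) = S *v x"
  by (simp add: Sigma_vec matrix_vector_right_distrib matrix_vector_mult_diff_distrib matrix_vector_mult_scaleR Pi_idem Pi_pinv_Q)

lemma Sigma_dot: "(S *v x) \<bullet> y = x \<bullet> (S *v y)"
  by (simp add: Sigma_vec inner_add_left inner_diff_left inner_add_right inner_diff_right pinv_Q_dot Pi_dot symmetric_dot[OF H_sym])

lemma Sigma_sym: "transpose S = S"
  by (rule dot_imp_symmetric) (rule Sigma_dot)

text \<open>The subtracted projection is absorbed by \<open>pinv Q\<close>: firm nonexpansiveness at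
  w = Q^+ x reads |Pi x|^2 = |Q w|^2 \<le> Q w . w = Q^+ x . x. The remaining term is the form of
  \<open>H\<close> at Pi x.\<close>

lemma Sigma_psd: "0 \<le> (S *v x) \<bullet> x"
proof -
  have "(Pr *v x) \<bullet> x = (norm (Pr *v x))\<^sup>2"
    by (metis Pi_dot Pi_idem power2_norm_eq_inner)
  also have "\<dots> \<le> (Q *v (q *v x)) \<bullet> (q *v x)" using Q_firmly_nonexpansive[of "q *v x"] by (simp add: Pi_vec)
  also have "\<dots> = (q *v x) \<bullet> x" by (metis Pi_vec Pi_pinv_Q Pi_dot inner_commute)
  finally have "(Pr *v x) \<bullet> x \<le> (q *v x) \<bullet> x" .
  moreover have "0 \<le> \<gamma> * ((Pr *v (H *v (Pr *v x))) \<bullet> x)"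
    using \<gamma> H_psd[of "Pr *v x"] by (simp add: Pi_dot)
  ultimately show ?thesis by (simp add: Sigma_vec inner_add_left inner_diff_left)
qed

section \<open>The matrix T and the inversion of H_eps\<close>

context
  fixes \<epsilon> :: real and T :: "real^'n^'n"
  assumes \<epsilon>: "\<epsilon> > 0"
  defines "T \<equiv> T_eps \<gamma> \<epsilon> D"
begin

lemma T_vec: "T *v x = S *v x + (\<gamma> * \<epsilon>) *\<^sub>R (Pr *v x)"
  by (simp add: T_def T_eps_def S_def Pr_def matrix_vector_mult_add_rdistrib matrix_scaleR_vector)

lemma T_sym: "transpose T = T"
  by (rule dot_imp_symmetric) (simp add: T_vec inner_add_left inner_add_right Sigma_dot Pi_dot)

lemma Pi_T: "Pr *v (T *v x) = T *v x"
  by (simp add: T_vec matrix_vector_right_distrib matrix_vector_mult_scaleR Pi_Sigma Pi_idem)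

text \<open>\<open>T\<close> commutes with its pseudoinverse, so the range of \<open>pinv T\<close>
  lies in that of \<open>T\<close>, hence in range(Q).\<close>

lemma Pi_pinv_T: "Pr *v (pinv T *v x) = pinv T *v x"
proof -
  have "pinv T *v x = T *v (pinv T *v (pinv T *v x))"
    by (metis matrix_vector_mul_assoc pinv_symmetric(3,5)[OF T_sym])
  then show ?thesis by (metis Pi_T)
qed

text \<open>T x . x is the sum of the nonnegative Sigma x . x and \<gamma> \<epsilon> |Pi x|^2. This
  is where the regularization acts: Sigma alone may vanish on part of range(Q).\<close>

lemma T_kernel:
  assumes "T *v x = 0"
  shows "Pr *v x = 0"
proof -
  have "0 = (T *v x) \<bullet> x" using assms by simp
  also have "\<dots> = (S *v x) \<bullet> x + \<gamma> * \<epsilon> * ((Pr *v x) \<bullet> (Pr *v x))"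
    by (simp add: T_vec inner_add_left) (metis Pi_dot Pi_idem)
  finally have "\<gamma> * \<epsilon> * ((Pr *v x) \<bullet> (Pr *v x)) \<le> 0" using Sigma_psd[of x] by linarith
  moreover have "\<gamma> * \<epsilon> > 0" using \<gamma> \<epsilon> by simp
  ultimately have "(Pr *v x) \<bullet> (Pr *v x) \<le> 0"
    using mult_pos_pos[of "\<gamma> * \<epsilon>" "(Pr *v x) \<bullet> (Pr *v x)"] by linarith
  then show ?thesis by (metis inner_eq_zero_iff inner_ge_zero order_antisym)
qed

lemma pinv_T_T: "pinv T *v (T *v x) = Pr *v x"
proof -
  have "T *v (x - pinv T *v (T *v x)) = 0"
    using pinv_symmetric(2)[OF T_sym] by (simp add: matrix_vector_mult_diff_distrib matrix_vector_mul_assoc matrix_mul_assoc)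
  then have "Pr *v (x - pinv T *v (T *v x)) = 0" by (rule T_kernel)
  then show ?thesis by (simp add: matrix_vector_mult_diff_distrib Pi_pinv_T)
qed

lemma T_pinv_T: "T *v (pinv T *v x) = Pr *v x"
  by (metis matrix_vector_mul_assoc pinv_symmetric(5)[OF T_sym] pinv_T_T)

text \<open>An eigenvector with l \<noteq> 0 lies in the range of Sigma, so the projection fixes it
  and T u = (l + \<gamma> \<epsilon>) u. For l = 0 both sides vanish, wherever \<open>u\<close> lies
  relative to range(Q).\<close>

lemma pinv_T_Sigma_eigenvector:
  assumes u: "S *v u = l *\<^sub>R u" "norm u = 1"
  shows "pinv T *v (S *v u) = (l / (l + \<gamma> * \<epsilon>)) *\<^sub>R u" "0 \<le> l"
proof -
  show l: "0 \<le> l" using Sigma_psd[of u] u by (simp add: norm_eq_1)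
  have p: "l + \<gamma> * \<epsilon> > 0" using l \<gamma> \<epsilon> by (simp add: add_nonneg_pos)
  show "pinv T *v (S *v u) = (l / (l + \<gamma> * \<epsilon>)) *\<^sub>R u"
  proof (cases "l = 0")
    case False
    have "l *\<^sub>R (Pr *v u) = l *\<^sub>R u"
      using Pi_Sigma[of u] by (simp add: u(1) matrix_vector_mult_scaleR)
    then have "Pr *v u = u" using False by simp
    then have "T *v u = (l + \<gamma> * \<epsilon>) *\<^sub>R u" by (simp add: T_vec u(1) scaleR_add_left)
    then have "(l + \<gamma> * \<epsilon>) *\<^sub>R (pinv T *v u) = u"
      using pinv_T_T[of u] \<open>Pr *v u = u\<close> by (simp add: matrix_vector_mult_scaleR)
    then have "(1 / (l + \<gamma> * \<epsilon>)) *\<^sub>R ((l + \<gamma> * \<epsilon>) *\<^sub>R (pinv T *v u)) = (1 / (l + \<gamma> * \<epsilon>)) *\<^sub>R u" by simp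
    then have "pinv T *v u = (1 / (l + \<gamma> * \<epsilon>)) *\<^sub>R u" using p by simp
    then show ?thesis by (simp add: u(1) matrix_vector_mult_scaleR)
  qed (simp add: u(1))
qed

lemma H_eps_vec: "H_eps \<gamma> \<epsilon> D *v x = x - Q *v ((1 - \<gamma> * \<epsilon>) *\<^sub>R x - \<gamma> *\<^sub>R (H *v x))"
  by (simp add: D matrix_vector_mult_diff_rdistrib matrix_scaleR_vector flip: matrix_vector_mul_assoc)

text \<open>A kernel vector satisfies x = Q w, and firm nonexpansiveness together with H \<ge> 0
  gives |x|^2 \<le> x . w \<le> (1 - \<gamma> \<epsilon>) |x|^2, so x = 0. The sign of 1 - \<gamma>
  \<epsilon> does not matter.\<close>

lemma H_eps_invertible: "invertible (H_eps \<gamma> \<epsilon> D)"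
proof -
  have "x = 0" if "H_eps \<gamma> \<epsilon> D *v x = 0" for x
  proof -
    define w where "w = (1 - \<gamma> * \<epsilon>) *\<^sub>R x - \<gamma> *\<^sub>R (H *v x)"
    have "x = Q *v w" using that by (simp add: H_eps_vec w_def)
    then have "x \<bullet> x \<le> x \<bullet> w" using Q_firmly_nonexpansive[of w] by (simp add: power2_norm_eq_inner)
    also have "\<dots> = (1 - \<gamma> * \<epsilon>) * (x \<bullet> x) - \<gamma> * ((H *v x) \<bullet> x)"
      by (simp add: w_def inner_diff_right inner_commute)
    also have "\<dots> \<le> (1 - \<gamma> * \<epsilon>) * (x \<bullet> x)" using \<gamma> H_psd[of x] by simp
    finally have "\<gamma> * \<epsilon> * (x \<bullet> x) \<le> 0" by (simp add: algebra_simps)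
    moreover have "\<gamma> * \<epsilon> > 0" using \<gamma> \<epsilon> by simp
    ultimately have "x \<bullet> x \<le> 0" using mult_pos_pos[of "\<gamma> * \<epsilon>" "x \<bullet> x"] by linarith
    then show ?thesis by (metis inner_eq_zero_iff inner_ge_zero order_antisym)
  qed
  then show ?thesis by (simp add: invertible_left_inverse matrix_left_invertible_ker)
qed

lemma V_vec: "V *v w = q *v (N *v w) - \<gamma> *\<^sub>R (Pr *v (H *v (N *v w - Pr *v (N *v w))))"
  by (simp add: V_def N_def q_def Pr_def D Let_def matrix_vector_mult_diff_rdistrib
      matrix_vector_mult_diff_distrib matrix_scaleR_vector flip: matrix_vector_mul_assoc)

text \<open>The candidate is z + y with z in the kernel of Q and y in its range. On these parts
  H_eps z = z + \<gamma> Q H z and H_eps y = Q T y, so the equation becomes Q T y = Pi n - \<gamma>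
  Q H z. The right side equals Q V w; this is the origin of the formula for V.\<close>

lemma H_eps_solution:
  "H_eps \<gamma> \<epsilon> D *v (N *v w - Pr *v (N *v w) + pinv T *v (V *v w)) = N *v w"
proof -
  define n where "n = N *v w"
  define y where "y = pinv T *v (V *v w)"
  define z where "z = n - Pr *v n"
  have Pz: "Q *v z = 0" by (simp add: z_def matrix_vector_mult_diff_distrib Q_Pi)
  have Py: "Pr *v y = y" by (simp add: y_def Pi_pinv_T)
  \<comment> \<open>T T^+ is the projection onto range(Q), which disappears under Q.\<close>
  have "Q *v (T *v y) = Q *v (V *v w)" by (simp add: y_def T_pinv_T Q_Pi)
  also have "\<dots> = Pr *v n - \<gamma> *\<^sub>R (Q *v (H *v z))"
    by (simp add: V_vec n_def z_def matrix_vector_mult_diff_distrib[of Q] matrix_vector_mult_scaleR Q_Pi Pi_vec[symmetric])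
  finally have QT: "Q *v (T *v y) = Pr *v n - \<gamma> *\<^sub>R (Q *v (H *v z))" .
  have "Q *v (T *v y) = y - (1 - \<gamma> * \<epsilon>) *\<^sub>R (Q *v y) + \<gamma> *\<^sub>R (Q *v (H *v y))"
    by (simp add: T_vec Sigma_vec Py matrix_vector_right_distrib matrix_vector_mult_diff_distrib
        matrix_vector_mult_scaleR Q_Pi Pi_vec[symmetric] scaleR_diff_left)
  moreover have "H_eps \<gamma> \<epsilon> D *v (z + y) = z + y - (1 - \<gamma> * \<epsilon>) *\<^sub>R (Q *v y) + \<gamma> *\<^sub>R (Q *v (H *v z)) + \<gamma> *\<^sub>R (Q *v (H *v y))"
    by (simp add: H_eps_vec matrix_vector_right_distrib matrix_vector_mult_diff_distrib
        matrix_vector_mult_scaleR Pz scaleR_add_right)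
  ultimately have "H_eps \<gamma> \<epsilon> D *v (z + y) = n" using QT by (simp add: z_def algebra_simps)
  then show ?thesis by (simp add: z_def y_def n_def)
qed

lemma J_eps_formula: "J_eps \<gamma> \<epsilon> D = - ((mat 1 - Pr) ** N) - pinv T ** V"
proof -
  define X where "X = (mat 1 - Pr) ** N + pinv T ** V"
  have "(H_eps \<gamma> \<epsilon> D ** X) *v w = N *v w" for w
    using H_eps_solution[of w]
    by (simp add: X_def matrix_vector_mult_add_rdistrib matrix_vector_mult_diff_rdistrib flip: matrix_vector_mul_assoc)
  then have "H_eps \<gamma> \<epsilon> D ** X = N" by (simp add: matrix_eq)
  \<comment> \<open>\<open>matrix_inv\<close> is a choice of inverse; invertibility provides the
    witness that gives it its property.\<close>
  moreover have "matrix_inv (H_eps \<gamma> \<epsilon> D) ** H_eps \<gamma> \<epsilon> D = mat 1"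
    using someI_ex[OF H_eps_invertible[unfolded invertible_def]] by (simp add: matrix_inv_def)
  ultimately have "matrix_inv (H_eps \<gamma> \<epsilon> D) ** N = X" by (metis matrix_mul_assoc matrix_mul_lid)
  then show ?thesis by (simp add: J_eps_def N_def X_def)
qed

end

end

subsection \<open>The limit\<close>

text \<open>Every ingredient is polynomial in the blocks and in \<open>pinv Q\<close>, so the
  constant rank of Q is the only thing needed beyond convergence of the blocks.\<close>

lemma blocks_tendsto:
  fixes D :: "nat \<Rightarrow> ('n::finite, 'm::finite) blocks"
  assumes D: "D \<longlonglongrightarrow> D0" and mono: "\<And>k. monotone_blocks (D k)"
    and rank: "\<forall>\<^sub>F k in sequentially. rank (Q_mat (D k)) = rank (Q_mat D0)"
  shows "(\<lambda>k. Pi_mat (D k)) \<longlonglongrightarrow> Pi_mat D0" "(\<lambda>k. M_mat \<gamma> (D k)) \<longlonglongrightarrow> M_mat \<gamma> D0"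
    "(\<lambda>k. Sigma_mat \<gamma> (D k)) \<longlonglongrightarrow> Sigma_mat \<gamma> D0" "(\<lambda>k. V_mat \<gamma> (D k)) \<longlonglongrightarrow> V_mat \<gamma> D0"
proof -
  define Q P H M where "Q k = fst (D k)" "P k = fst (snd (D k))" "H k = fst (snd (snd (D k)))" "M k = snd (snd (snd (D k)))" for k
  obtain Q0 P0 H0 M0 where D0: "D0 = (Q0, P0, H0, M0)" by (cases D0)
  have Dk: "D k = (Q k, P k, H k, M k)" for k by (simp add: Q_P_H_M_def)
  have Q: "Q \<longlonglongrightarrow> Q0" and P: "P \<longlonglongrightarrow> P0" and H: "H \<longlonglongrightarrow> H0" and M: "M \<longlonglongrightarrow> M0"
    using tendsto_fst[OF D] tendsto_fst[OF tendsto_snd[OF D]] tendsto_fst[OF tendsto_snd[OF tendsto_snd[OF D]]]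
      tendsto_snd[OF tendsto_snd[OF tendsto_snd[OF D]]]
    by (simp_all add: Q_P_H_M_def[abs_def] D0)
  have "transpose (Q k) = Q k" for k using mono[of k] by (simp add: monotone_blocks_def Dk)
  then have q: "(\<lambda>k. pinv (Q k)) \<longlonglongrightarrow> pinv Q0"
    using rank by (intro pinv_tendsto_of_constant_rank Q) (simp_all add: Dk D0)
  show "(\<lambda>k. Pi_mat (D k)) \<longlonglongrightarrow> Pi_mat D0" "(\<lambda>k. M_mat \<gamma> (D k)) \<longlonglongrightarrow> M_mat \<gamma> D0"
    "(\<lambda>k. Sigma_mat \<gamma> (D k)) \<longlonglongrightarrow> Sigma_mat \<gamma> D0" "(\<lambda>k. V_mat \<gamma> (D k)) \<longlonglongrightarrow> V_mat \<gamma> D0"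
    unfolding Dk D0 Pi_mat.simps M_mat.simps Sigma_mat.simps V_mat.simps Let_def
    by (intro tendsto_intros tendsto_matrix_mult q Q P H M)+
qed

text \<open>Below the gap the only possible eigenvalue is 0, so a vanishing ordered eigenvalue is
  eventually exactly 0 and thus small against any sequence.\<close>

lemma eigvals_smallo_of_spectral_gap:
  fixes A :: "nat \<Rightarrow> real^'n^'n"
  assumes sym: "\<And>k. transpose (A k) = A k" and "\<mu> > 0"
    and gap: "\<forall>\<^sub>F k in sequentially. spec_real (A k) \<subseteq> {0} \<union> {\<mu>..}"
    and i: "i < CARD('n)" and lim: "(\<lambda>k. eigvals_desc (A k) ! i) \<longlonglongrightarrow> 0"
  shows "(\<lambda>k. eigvals_desc (A k) ! i) \<in> o(\<epsilon>)"
proof -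
  have spec: "eigvals_desc (A k) ! i \<in> spec_real (A k)" for k
  proof -
    obtain U l where e: "eigensystem (A k) U l" "eigvals_desc (A k) = map (\<lambda>i. l $ i) index_list"
      by (rule ordered_eigensystem_exists[OF sym])
    let ?j = "index_list ! i :: 'n"
    have "U $ ?j \<bullet> U $ ?j = 1" "A k *v (U $ ?j) = l $ ?j *\<^sub>R U $ ?j" using e(1) by (auto simp: eigensystem_def)
    then have "l $ ?j \<in> spec_real (A k)" unfolding spec_real_def by (auto intro!: exI[of _ "U $ ?j"])
    then show ?thesis using i by (simp add: e(2) length_index_list)
  qed
  have "\<forall>\<^sub>F k in sequentially. eigvals_desc (A k) ! i < \<mu>" using order_tendstoD(2)[OF lim \<open>\<mu> > 0\<close>] .
  then have "\<forall>\<^sub>F k in sequentially. eigvals_desc (A k) ! i = 0"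
    using gap by eventually_elim (use spec in fastforce)
  then show ?thesis by (subst landau_o.small.in_cong[where g = "\<lambda>_. 0"]) auto
qed

lemma pinv_T_Sigma_tendsto:
  fixes D :: "nat \<Rightarrow> ('n::finite, 'm::finite) blocks"
  assumes mono: "\<And>k. monotone_blocks (D k)" and \<gamma>: "\<gamma> > 0" and \<epsilon>: "\<epsilon> \<longlonglongrightarrow> 0" "\<And>k. \<epsilon> k > 0"
    and S: "(\<lambda>k. Sigma_mat \<gamma> (D k)) \<longlonglongrightarrow> S0"
    and small: "\<And>i. i < CARD('n) \<Longrightarrow> (\<lambda>k. eigvals_desc (Sigma_mat \<gamma> (D k)) ! i) \<longlonglongrightarrow> 0 \<Longrightarrow>
      (\<lambda>k. eigvals_desc (Sigma_mat \<gamma> (D k)) ! i) \<in> o(\<epsilon>)"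
  shows "(\<lambda>k. pinv (T_eps \<gamma> (\<epsilon> k) (D k)) ** Sigma_mat \<gamma> (D k)) \<longlonglongrightarrow> pinv S0 ** S0"
proof -
  define Sk where "Sk k = Sigma_mat \<gamma> (D k)" for k
  define R where "R k = pinv (T_eps \<gamma> (\<epsilon> k) (D k)) ** Sk k" for k
  have sym: "transpose (Sk k) = Sk k" for k
    using Sigma_sym[OF _ mono \<gamma>] unfolding Sk_def by (metis prod.collapse)
  have S: "Sk \<longlonglongrightarrow> S0" using S by (simp add: Sk_def[abs_def])
  have "\<forall>k. \<exists>U l. eigensystem (Sk k) U l \<and> eigvals_desc (Sk k) = map (\<lambda>i. l $ i) index_list"
    using ordered_eigensystem_exists[OF sym] by blast
  then obtain U l where e: "\<And>k. eigensystem (Sk k) (U k) (l k)"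
    "\<And>k. eigvals_desc (Sk k) = map (\<lambda>i. l k $ i) index_list" by metis
  have eig: "Sk k *v (U k $ i) = l k $ i *\<^sub>R U k $ i" "norm (U k $ i) = 1" for k i
    using e(1)[of k] by (auto simp: eigensystem_def norm_eq_1)
  have Rl: "R k *v (U k $ i) = (l k $ i / (l k $ i + \<gamma> * \<epsilon> k)) *\<^sub>R U k $ i" "0 \<le> l k $ i" for k i
  proof -
    obtain Q P H M where Dk: "D k = (Q, P, H, M)" by (cases "D k")
    show "R k *v (U k $ i) = (l k $ i / (l k $ i + \<gamma> * \<epsilon> k)) *\<^sub>R U k $ i" "0 \<le> l k $ i"
      using pinv_T_Sigma_eigenvector[OF Dk mono \<gamma> \<epsilon>(2) eig[of k i, unfolded Sk_def]]
      by (simp_all add: R_def Sk_def flip: matrix_vector_mul_assoc)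
  qed
  have R: "R k = spectral_matrix (U k) (\<chi> i. l k $ i / (l k $ i + \<gamma> * \<epsilon> k))" for k
  proof -
    have "orthogonal_matrix (U k)" using e(1) by (rule eigensystem_orthogonal)
    then show ?thesis by (rule orthogonal_matrix_eqI) (simp add: Rl spectral_matrix_eigen[OF \<open>orthogonal_matrix (U k)\<close>])
  qed
  have "R \<longlonglongrightarrow> pinv S0 ** S0"
  proof (rule tendsto_of_subsequences)
    fix r :: "nat \<Rightarrow> nat" assume r: "strict_mono r"
    obtain s U0 l0 where s: "strict_mono s" and U0: "(\<lambda>k. U (r (s k))) \<longlonglongrightarrow> U0" and l0: "(\<lambda>k. l (r (s k))) \<longlonglongrightarrow> l0"
      and e0: "eigensystem S0 U0 l0" "eigvals_desc S0 = map (\<lambda>i. l0 $ i) index_list"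
      by (rule eigensystem_subsequence[OF S e r])
    have rs: "strict_mono (r \<circ> s)" using r s by (rule strict_mono_o)
    \<comment> \<open>With \<open>inverse 0 = 0\<close> the limit is 0 or 1, the eigenvalue of
      \<open>pinv S0 ** S0\<close>.\<close>
    have ratio: "(\<lambda>k. l (r (s k)) $ i / (l (r (s k)) $ i + \<gamma> * \<epsilon> (r (s k)))) \<longlonglongrightarrow> inverse (l0 $ i) * l0 $ i" for i
    proof (cases "l0 $ i = 0")
      case True
      have "i \<in> set index_list" by (simp add: index_list)
      then obtain j where j: "j < CARD('n)" "index_list ! j = i"
        by (auto simp: in_set_conv_nth length_index_list)
      have nth: "eigvals_desc (Sk k) ! j = l k $ i" for k using j by (simp add: e(2) length_index_list)
      \<comment> \<open>\<open>l0\<close> arose from a subsequence, while \<open>small\<close> asks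
        for convergence along the whole sequence; continuity of the ordered eigenvalues bridges the
        gap.\<close>
      have "(\<lambda>k. l k $ i) \<longlonglongrightarrow> l0 $ i"
        using eigvals_desc_tendsto[OF S sym j(1)] j by (simp add: nth) (simp add: e0(2) length_index_list)
      then have "(\<lambda>k. l k $ i) \<in> o(\<epsilon>)"
        using small[OF j(1), folded Sk_def] by (simp add: nth True)
      then have "(\<lambda>k. l k $ i / \<epsilon> k) \<longlonglongrightarrow> 0" by (rule smalloD_tendsto)
      then have "(\<lambda>k. (l k $ i / \<epsilon> k) / \<gamma>) \<longlonglongrightarrow> 0 / \<gamma>" using \<gamma> by (intro tendsto_divide tendsto_const) auto
      then have up: "(\<lambda>k. (l k $ i / \<epsilon> k) / \<gamma>) \<longlonglongrightarrow> 0" by simp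
      have "(\<lambda>k. l k $ i / (l k $ i + \<gamma> * \<epsilon> k)) \<longlonglongrightarrow> 0"
      \<comment> \<open>Since l \<ge> 0, dropping l from the denominator gives 0 \<le> l / (l +
        \<gamma> \<epsilon>) \<le> (l / \<epsilon>) / \<gamma>.\<close>
      proof (rule tendsto_sandwich[OF _ _ tendsto_const up])
        have p: "0 < \<gamma> * \<epsilon> k" for k using \<gamma> \<epsilon>(2) by simp
        show "\<forall>\<^sub>F k in sequentially. 0 \<le> l k $ i / (l k $ i + \<gamma> * \<epsilon> k)"
          using Rl(2) p by (intro always_eventually allI divide_nonneg_nonneg add_nonneg_nonneg) (auto intro: less_imp_le)
        have "l k $ i / (l k $ i + \<gamma> * \<epsilon> k) \<le> l k $ i / (\<gamma> * \<epsilon> k)" for k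
          using Rl(2)[of k i] p[of k] by (intro divide_left_mono) (auto intro!: mult_pos_pos add_nonneg_pos)
        then show "\<forall>\<^sub>F k in sequentially. l k $ i / (l k $ i + \<gamma> * \<epsilon> k) \<le> (l k $ i / \<epsilon> k) / \<gamma>"
          by (simp add: mult.commute)
      qed
      then show ?thesis using LIMSEQ_subseq_LIMSEQ[OF _ rs] True by (simp add: o_def)
    next
      case False
      have "(\<lambda>k. \<epsilon> (r (s k))) \<longlonglongrightarrow> 0" using LIMSEQ_subseq_LIMSEQ[OF \<epsilon>(1) rs] by (simp add: o_def)
      then have "(\<lambda>k. l (r (s k)) $ i / (l (r (s k)) $ i + \<gamma> * \<epsilon> (r (s k)))) \<longlonglongrightarrow> l0 $ i / (l0 $ i + \<gamma> * 0)"
        using False by (intro tendsto_divide tendsto_add tendsto_mult tendsto_const tendsto_vec_nth l0) auto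
      then show ?thesis using False by simp
    qed
    have "(\<lambda>k. R (r (s k))) \<longlonglongrightarrow> spectral_matrix U0 (\<chi> i. inverse (l0 $ i) * l0 $ i)"
      unfolding R using ratio by (intro tendsto_spectral_matrix U0 vec_tendstoI) simp
    also have "spectral_matrix U0 (\<chi> i. inverse (l0 $ i) * l0 $ i) = pinv S0 ** S0"
      using e0(1) by (simp add: eigensystem_iff pinv_spectral_matrix spectral_matrix_mult)
    finally show "\<exists>s. strict_mono s \<and> (\<lambda>k. R (r (s k))) \<longlonglongrightarrow> pinv S0 ** S0" using s by blast
  qed
  then show ?thesis by (simp add: R_def[abs_def] Sk_def)
qed

text \<open>The range assumption bounds the operator norm, whereas extracting a convergent
  subsequence requires boundedness in the norm of the matrix type.\<close>

lemma norm_le_opnorm: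
  fixes A :: "real^'n^'m"
  shows "norm A \<le> CARD('m) * (CARD('n) * opnorm A)"
proof -
  have "norm A \<le> (\<Sum>i\<in>UNIV. norm (A $ i))"
    unfolding norm_vec_def[of A] by (rule L2_set_le_sum) simp
  also have "\<dots> \<le> (\<Sum>i\<in>(UNIV::'m set). \<Sum>j\<in>(UNIV::'n set). \<bar>A $ i $ j\<bar>)"
    by (intro sum_mono norm_le_l1_cart)
  also have "\<dots> \<le> (\<Sum>i\<in>(UNIV::'m set). \<Sum>j\<in>(UNIV::'n set). opnorm A)"
    unfolding opnorm_def by (intro sum_mono matrix_component_le_onorm)
  finally show ?thesis by simp
qed

text \<open>S S^+ acts as the identity on the range of S, which contains that of V.\<close>

lemma pinv_range_factor:
  fixes S :: "real^'n^'n" and V :: "real^'m^'n"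
  assumes "transpose S = S" and "range (\<lambda>v. V *v v) \<subseteq> range (\<lambda>u. S *v u)"
  shows "S ** (pinv S ** V) = V"
proof -
  have "S *v (pinv S *v (V *v v)) = V *v v" for v
  proof -
    obtain u where "V *v v = S *v u" using assms(2) by blast
    then show ?thesis using pinv_symmetric(2)[OF assms(1)] by (simp add: matrix_vector_mul_assoc matrix_mul_assoc)
  qed
  then show ?thesis by (simp add: matrix_eq flip: matrix_vector_mul_assoc)
qed

theorem corollary26:
  fixes S :: "nat \<Rightarrow> real list set set"
    and \<Theta> \<O> :: "(real^'m) set"
    and f :: "real^'n \<Rightarrow> real^'m \<Rightarrow> real"
    and g :: "real^'n \<Rightarrow> real^'m \<Rightarrow> ereal"
    and L \<epsilon>\<^sub>b \<gamma> :: real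
    and \<theta> :: "real^'m"
    and \<epsilon> :: "nat \<Rightarrow> real"
    and D :: "nat \<Rightarrow> ('n, 'm) blocks"
    and D0 :: "('n, 'm) blocks"
  assumes "o_minimal_structure S"
    and "\<O> \<subseteq> \<Theta>" and "open \<O>" and "definable_set S \<O>"
    and "composite_definability S \<Theta> \<O> f g"
    and "composite_regularity \<O> f g L \<epsilon>\<^sub>b \<gamma>"
    and "composite_uniform_range \<O> f g \<epsilon>\<^sub>b \<gamma>"
    and "composite_uniform_kernel \<O> f g \<epsilon>\<^sub>b \<gamma>"
    and "\<theta> \<in> \<O>"
    and "\<epsilon> \<longlonglongrightarrow> 0" and "\<And>k. 0 < \<epsilon> k \<and> \<epsilon> k \<le> \<epsilon>\<^sub>b"
    and "\<And>k. D k \<in> D_set f g \<gamma> (\<epsilon> k) (xstar f g (\<epsilon> k) \<theta>) \<theta>"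
    and "D \<longlonglongrightarrow> D0"
    and "\<forall>\<^sub>F k in sequentially. rank (Q_mat (D k)) = rank (Q_mat D0)"
    and "(\<exists>\<mu> > 0. \<forall>\<^sub>F k in sequentially. spec_real (Sigma_mat \<gamma> (D k)) \<subseteq> {0} \<union> {\<mu>..}) \<or>
         (\<forall>i < CARD('n). (\<lambda>k. eigvals_desc (Sigma_mat \<gamma> (D k)) ! i) \<longlonglongrightarrow> 0 \<longrightarrow>
            (\<lambda>k. eigvals_desc (Sigma_mat \<gamma> (D k)) ! i) \<in> o(\<epsilon>))"
  shows
    "(\<forall>k. invertible (H_eps \<gamma> (\<epsilon> k) (D k)) \<and>
          J_eps \<gamma> (\<epsilon> k) (D k) =
            - ((mat 1 - Pi_mat (D k)) ** M_mat \<gamma> (D k)) - pinv (T_eps \<gamma> (\<epsilon> k) (D k)) ** V_mat \<gamma> (D k)) \<and>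
     (\<forall>J. cluster_point (\<lambda>k. J_eps \<gamma> (\<epsilon> k) (D k)) J \<longrightarrow>
        J = - ((mat 1 - Pi_mat D0) ** M_mat \<gamma> D0) - pinv (Sigma_mat \<gamma> D0) ** V_mat \<gamma> D0 \<and>
        (\<exists>r R W. strict_mono r \<and>
           (\<lambda>k. J_eps \<gamma> (\<epsilon> (r k)) (D (r k))) \<longlonglongrightarrow> J \<and>
           (\<lambda>k. pinv (T_eps \<gamma> (\<epsilon> (r k)) (D (r k))) ** Sigma_mat \<gamma> (D (r k))) \<longlonglongrightarrow> R \<and>
           (\<lambda>k. pinv (Sigma_mat \<gamma> (D (r k))) ** V_mat \<gamma> (D (r k))) \<longlonglongrightarrow> W \<and>
           (let S0 = R - pinv (Sigma_mat \<gamma> D0) ** Sigma_mat \<gamma> D0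
            in J = - ((mat 1 - Pi_mat D0) ** M_mat \<gamma> D0)
                   - pinv (Sigma_mat \<gamma> D0) ** V_mat \<gamma> D0 - S0 ** W \<and>
               S0 = 0)))"
proof -
  have \<gamma>: "\<gamma> > 0" using assms(6) by (simp add: composite_regularity_def)
  have \<epsilon>: "\<epsilon> k > 0" for k using assms(11) by blast
  have mono: "monotone_blocks (D k)" for k
    using assms(3,6,9,12) by (intro D_set_monotone_blocks) auto
  have sym: "transpose (Sigma_mat \<gamma> (D k)) = Sigma_mat \<gamma> (D k)" for k
    using Sigma_sym[OF _ mono \<gamma>] by (metis prod.collapse)
  have inv: "invertible (H_eps \<gamma> (\<epsilon> k) (D k))" for k
    using H_eps_invertible[OF _ mono \<gamma> \<epsilon>] by (metis prod.collapse)
  have J: "J_eps \<gamma> (\<epsilon> k) (D k) =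
      - ((mat 1 - Pi_mat (D k)) ** M_mat \<gamma> (D k)) - pinv (T_eps \<gamma> (\<epsilon> k) (D k)) ** V_mat \<gamma> (D k)" for k
    using J_eps_formula[OF _ mono \<gamma> \<epsilon>] by (metis prod.collapse)
  note lim = blocks_tendsto[OF assms(13) mono assms(14)]
  define R where "R k = pinv (T_eps \<gamma> (\<epsilon> k) (D k)) ** Sigma_mat \<gamma> (D k)" for k
  define W where "W k = pinv (Sigma_mat \<gamma> (D k)) ** V_mat \<gamma> (D k)" for k
  define R0 where "R0 = pinv (Sigma_mat \<gamma> D0) ** Sigma_mat \<gamma> D0"
  have small: "(\<lambda>k. eigvals_desc (Sigma_mat \<gamma> (D k)) ! i) \<in> o(\<epsilon>)"
    if "i < CARD('n)" "(\<lambda>k. eigvals_desc (Sigma_mat \<gamma> (D k)) ! i) \<longlonglongrightarrow> 0" for i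
    using assms(15) eigvals_smallo_of_spectral_gap[OF sym _ _ that] that by blast
  have R: "R \<longlonglongrightarrow> R0"
    using pinv_T_Sigma_tendsto[OF mono \<gamma> assms(10) \<epsilon> lim(3) small] by (simp add: R_def[abs_def] R0_def)
  obtain C where C: "\<And>k. range (\<lambda>v. V_mat \<gamma> (D k) *v v) \<subseteq> range (\<lambda>u. Sigma_mat \<gamma> (D k) *v u)"
    "\<And>k. opnorm (W k) \<le> C"
  proof -
    \<comment> \<open>A single point suffices as compact set: the uniformity that counts here is the
      one in \<epsilon>.\<close>
    have "compact {\<theta>} \<and> {\<theta>} \<subseteq> \<O>" using assms(9) by simp
    then obtain C where C: "\<forall>e\<in>{0<..\<epsilon>\<^sub>b}. \<forall>D\<in>D_set f g \<gamma> e (xstar f g e \<theta>) \<theta>.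
          range (\<lambda>v. V_mat \<gamma> D *v v) \<subseteq> range (\<lambda>u. Sigma_mat \<gamma> D *v u) \<and>
          opnorm (pinv (Sigma_mat \<gamma> D) ** V_mat \<gamma> D) \<le> C"
      using assms(7) unfolding composite_uniform_range_def by (metis singletonI)
    have "\<epsilon> k \<in> {0<..\<epsilon>\<^sub>b}" for k using assms(11) by simp
    then have "range (\<lambda>v. V_mat \<gamma> (D k) *v v) \<subseteq> range (\<lambda>u. Sigma_mat \<gamma> (D k) *v u)" "opnorm (W k) \<le> C" for k
      using C assms(12) unfolding W_def by blast+
    then show ?thesis using that by blast
  qed
  have SW: "Sigma_mat \<gamma> (D k) ** W k = V_mat \<gamma> (D k)" for k
    unfolding W_def by (rule pinv_range_factor[OF sym C(1)])
  have TV: "pinv (T_eps \<gamma> (\<epsilon> k) (D k)) ** V_mat \<gamma> (D k) = R k ** W k" for k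
    by (simp add: R_def SW flip: matrix_mul_assoc)
  have "norm (W k) \<le> CARD('n) * (CARD('m) * C)" for k
    by (rule order_trans[OF norm_le_opnorm]) (intro mult_left_mono C, simp_all)
  then have bounded: "bounded (range (\<lambda>k. W (r k)))" for r :: "nat \<Rightarrow> nat"
    by (auto simp: bounded_iff)
  have key: "J' = - ((mat 1 - Pi_mat D0) ** M_mat \<gamma> D0) - pinv (Sigma_mat \<gamma> D0) ** V_mat \<gamma> D0 \<and>
      (\<exists>r W0. strict_mono r \<and> (\<lambda>k. J_eps \<gamma> (\<epsilon> (r k)) (D (r k))) \<longlonglongrightarrow> J' \<and>
         (\<lambda>k. R (r k)) \<longlonglongrightarrow> R0 \<and> (\<lambda>k. W (r k)) \<longlonglongrightarrow> W0)"
    if J': "cluster_point (\<lambda>k. J_eps \<gamma> (\<epsilon> k) (D k)) J'" for J'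
  proof -
    obtain t where t: "strict_mono t" and Jt: "((\<lambda>k. J_eps \<gamma> (\<epsilon> k) (D k)) \<circ> t) \<longlonglongrightarrow> J'"
      using J' by (auto simp: cluster_point_def)
    obtain W0 s where s: "strict_mono s" and Ws: "((\<lambda>k. W (t k)) \<circ> s) \<longlonglongrightarrow> W0"
      using bounded_imp_convergent_subsequence[OF bounded[of t]] by blast
    define r where "r = t \<circ> s"
    have r: "strict_mono r" unfolding r_def using t s by (rule strict_mono_o)
    have W: "(\<lambda>k. W (r k)) \<longlonglongrightarrow> W0" using Ws by (simp add: r_def o_def)
    have Jr: "(\<lambda>k. J_eps \<gamma> (\<epsilon> (r k)) (D (r k))) \<longlonglongrightarrow> J'"
      using LIMSEQ_subseq_LIMSEQ[OF Jt s] by (simp add: r_def o_def)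
    note sub = LIMSEQ_subseq_LIMSEQ[OF _ r, unfolded o_def]
    have "(\<lambda>k. Sigma_mat \<gamma> (D (r k)) ** W (r k)) \<longlonglongrightarrow> Sigma_mat \<gamma> D0 ** W0"
      by (intro tendsto_matrix_mult W sub[OF lim(3)])
    \<comment> \<open>The range condition survives in the limit through the bounded factor W, even
      where the rank of Sigma drops.\<close>
    then have V0: "Sigma_mat \<gamma> D0 ** W0 = V_mat \<gamma> D0"
      unfolding SW using sub[OF lim(4)] by (rule LIMSEQ_unique)
    have "(\<lambda>k. - ((mat 1 - Pi_mat (D (r k))) ** M_mat \<gamma> (D (r k))) - R (r k) ** W (r k))
        \<longlonglongrightarrow> - ((mat 1 - Pi_mat D0) ** M_mat \<gamma> D0) - R0 ** W0"
      by (intro tendsto_intros tendsto_matrix_mult W sub[OF lim(1)] sub[OF lim(2)] sub[OF R])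
    then have "J' = - ((mat 1 - Pi_mat D0) ** M_mat \<gamma> D0) - R0 ** W0"
      by (rule LIMSEQ_unique[OF Jr[unfolded J TV]])
    \<comment> \<open>R0 sees W0 only through Sigma_0 W0 = V_0, so the value does not depend on the
      subsequence that produced W0.\<close>
    also have "R0 ** W0 = pinv (Sigma_mat \<gamma> D0) ** V_mat \<gamma> D0"
      by (simp add: R0_def V0 flip: matrix_mul_assoc)
    finally show ?thesis using r Jr sub[OF R] W by blast
  qed
  show ?thesis
  proof (intro conjI allI impI)
    fix J' assume "cluster_point (\<lambda>k. J_eps \<gamma> (\<epsilon> k) (D k)) J'"
    note key = key[OF this]
    then show J'_eq: "J' = - ((mat 1 - Pi_mat D0) ** M_mat \<gamma> D0) - pinv (Sigma_mat \<gamma> D0) ** V_mat \<gamma> D0"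
      by (rule conjunct1)
    obtain r W0 where "strict_mono r" "(\<lambda>k. J_eps \<gamma> (\<epsilon> (r k)) (D (r k))) \<longlonglongrightarrow> J'"
      "(\<lambda>k. R (r k)) \<longlonglongrightarrow> R0" "(\<lambda>k. W (r k)) \<longlonglongrightarrow> W0"
      using key by blast
    then show "\<exists>r R W. strict_mono r \<and>
           (\<lambda>k. J_eps \<gamma> (\<epsilon> (r k)) (D (r k))) \<longlonglongrightarrow> J' \<and>
           (\<lambda>k. pinv (T_eps \<gamma> (\<epsilon> (r k)) (D (r k))) ** Sigma_mat \<gamma> (D (r k))) \<longlonglongrightarrow> R \<and>
           (\<lambda>k. pinv (Sigma_mat \<gamma> (D (r k))) ** V_mat \<gamma> (D (r k))) \<longlonglongrightarrow> W \<and>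
           (let S0 = R - pinv (Sigma_mat \<gamma> D0) ** Sigma_mat \<gamma> D0
            in J' = - ((mat 1 - Pi_mat D0) ** M_mat \<gamma> D0)
                   - pinv (Sigma_mat \<gamma> D0) ** V_mat \<gamma> D0 - S0 ** W \<and>
               S0 = 0)"
      by (intro exI[of _ r] exI[of _ R0] exI[of _ W0]) (simp add: R_def W_def R0_def Let_def J'_eq)
  qed (fact inv J)+
qed

end
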